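(* Let $p$ be an odd rational prime, let $\zeta_p$ be a primitive $p$-th root of unity, and let $(1-\zeta_p)$ be the unique prime of $\mathbb{Z}[\zeta_p]$ above $p$. Let $\alpha\in\mathbb{Z}[\zeta_p]$ and suppose that $x^p-\alpha$ is irreducible in $\mathbb{Z}[\zeta_p][x]$. Let $\sqrt[p]{\alpha}$ be a root of $x^p-\alpha$. Then the ring of integers of $\mathbb{Q}(\zeta_p,\sqrt[p]{\alpha})$ is $\mathbb{Z}[\zeta_p][\sqrt[p]{\alpha}]$ if and only if $\alpha$ is square-free as an ideal of $\mathbb{Z}[\zeta_p]$ and the congruence $$\alpha^p\equiv\alpha \pmod{(1-\zeta_p)^2}$$ is not satisfied.
   Context: "$\alpha$ is square-free as an ideal" means that the principal ideal $(\alpha)$ is not divisible by the square of any prime ideal; the unit ideal counts as square-free. *)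

theory Defs
  imports
    Complex_Main
    "HOL-Computational_Algebra.Computational_Algebra"
    "HOL-Algebra.Ideal_Product"
    "HOL-Algebra.Generated_Fields"
    "HOL-Algebra.Algebraic_Closure_Type"
begin

definition primitive_root_of_unity :: "nat \<Rightarrow> 'a::field \<Rightarrow> bool" where
  "primitive_root_of_unity n z \<longleftrightarrow>
     n > 0 \<and> z ^ n = 1 \<and> (\<forall>k. 0 < k \<and> k < n \<longrightarrow> z ^ k \<noteq> 1)"

text \<open>Subrings of a type-class ring are represented by their carrier sets;
  \<open>subring_on S\<close> turns such a set into a ring structure, so that the ideal-theoretic and
  divisibility notions of HOL-Algebra are relative to \<open>S\<close> and not to the whole type.\<close>

definition subring_on :: "'a::comm_ring_1 set \<Rightarrow> 'a ring" where
  "subring_on S = ring_of_type_algebra\<lparr>carrier := S\<rparr>"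

text \<open>The polynomial ring $S[x]$ inside the polynomials over the ambient type.\<close>

definition polys_over :: "'a::comm_ring_1 set \<Rightarrow> 'a poly set" where
  "polys_over S = {f. \<forall>i. coeff f i \<in> S}"

text \<open>The ring $S[a]$, for a subring $S$ of the ambient ring.\<close>

definition ring_adjoin :: "'a::comm_ring_1 set \<Rightarrow> 'a \<Rightarrow> 'a set" where
  "ring_adjoin S a = {poly f a | f. f \<in> polys_over S}"

text \<open>\<open>generate_field\<close> yields the smallest subfield containing the given set. The prime field of
  the complex numbers is $\mathbf{Q}$, so this is $\mathbf{Q}(A)$.\<close>

definition rat_adjoin :: "complex set \<Rightarrow> complex set" where
  "rat_adjoin A = generate_field ring_of_type_algebra A"

definition ring_of_integers :: "complex set \<Rightarrow> complex set" where
  "ring_of_integers K = {x \<in> K. algebraic_int x}"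

definition ideal_dvd :: "'a ring \<Rightarrow> 'a set \<Rightarrow> 'a set \<Rightarrow> bool" where
  "ideal_dvd R I J \<longleftrightarrow> (\<exists>L. ideal L R \<and> J = I \<cdot>\<^bsub>R\<^esub> L)"

definition squarefree_ideal :: "'a ring \<Rightarrow> 'a set \<Rightarrow> bool" where
  "squarefree_ideal R I \<longleftrightarrow> \<not> (\<exists>P. primeideal P R \<and> ideal_dvd R (P \<cdot>\<^bsub>R\<^esub> P) I)"

definition cong_mod_ideal :: "'a::comm_ring_1 \<Rightarrow> 'a \<Rightarrow> 'a set \<Rightarrow> bool" where
  "cong_mod_ideal a b I \<longleftrightarrow> a - b \<in> I"

abbreviation cyclotomic_ring :: "complex \<Rightarrow> complex set" where
  "cyclotomic_ring \<zeta> \<equiv> ring_adjoin \<int> \<zeta>"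

end

theory Submission
  imports Defs "Jordan_Normal_Form.Char_Poly" "HOL-Number_Theory.Residues"
begin

text \<open>Write \<open>R = \<int>[\<zeta>]\<close>, \<open>K = \<rat>(\<zeta>)\<close>, \<open>\<pi> = 1 - \<zeta>\<close> and \<open>B = R[\<beta>]\<close>. Then \<open>p\<close> is a unit times \<open>\<pi>\<^sup>p\<^sup>-\<^sup>1\<close>, and
  \<open>R\<close> is the maximal order of \<open>K\<close>, in which \<open>(\<alpha>)\<close> is square-free if and only if \<open>R / (\<alpha>)\<close> is
  reduced, that is, if \<open>\<alpha>\<close> divides every \<open>j\<close> whose square it divides.

  If \<open>\<alpha>\<close> divides \<open>j\<^sup>2\<close> but not \<open>j\<close>, then \<open>(j / \<alpha>) \<beta>\<^sup>p\<^sup>-\<^sup>1\<close> is integral; if \<open>\<pi>\<^sup>2\<close> divides \<open>\<alpha>\<^sup>p - \<alpha>\<close>, then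
  \<open>\<pi>\<^sup>2\<close> divides \<open>(\<beta> - \<alpha>)\<^sup>p\<close> and \<open>(\<beta> - \<alpha>)\<^sup>p\<^sup>-\<^sup>1 / \<pi>\<close> is integral. Neither element lies in \<open>B\<close>, because
  \<open>x\<^sup>p - \<alpha>\<close> is the minimal polynomial of \<open>\<beta>\<close> over \<open>K\<close>.

  Conversely let \<open>x = \<Sum> c\<^sub>i \<beta>\<^sup>i\<close> be integral. Averaging the conjugates of \<open>x\<close> against powers of \<open>\<zeta>\<close>
  shows that \<open>p c\<^sub>i \<beta>\<^sup>i\<close> is integral. Hence the \<open>p\<close>-th power of \<open>p c\<^sub>i \<alpha>\<close> lies in \<open>(\<alpha>)\<close>, and \<open>p c\<^sub>i \<in> R\<close>
  because \<open>R / (\<alpha>)\<close> is reduced. It remains to remove powers of \<open>\<pi>\<close>, which is Eisenstein's argument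
  for \<open>\<beta> - \<alpha>\<close>, whose norm \<open>\<alpha> - \<alpha>\<^sup>p\<close> is exactly divisible by \<open>\<pi>\<close>.\<close>

hide_const (open) Polynomials.degree UnivPoly.monom Module.smult Divisibility.prime

section \<open>Subrings and subfields\<close>

locale subring_set =
  fixes S :: "'a::comm_ring_1 set"
  assumes one_mem: "1 \<in> S"
    and diff_mem: "x \<in> S \<Longrightarrow> y \<in> S \<Longrightarrow> x - y \<in> S"
    and mult_mem: "x \<in> S \<Longrightarrow> y \<in> S \<Longrightarrow> x * y \<in> S"
begin

lemma zero_mem: "0 \<in> S"
  using diff_mem[OF one_mem one_mem] by simp

lemma minus_mem: "x \<in> S \<Longrightarrow> - x \<in> S"
  using diff_mem[OF zero_mem, of x] by simp

lemma add_mem: "x \<in> S \<Longrightarrow> y \<in> S \<Longrightarrow> x + y \<in> S"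
  using diff_mem[OF _ minus_mem, of x y] by simp

lemma power_mem: "x \<in> S \<Longrightarrow> x ^ n \<in> S"
  by (induction n) (auto intro: one_mem mult_mem)

lemma sum_mem: "(\<And>i. i \<in> I \<Longrightarrow> f i \<in> S) \<Longrightarrow> sum f I \<in> S"
  by (induction I rule: infinite_finite_induct) (auto intro: zero_mem add_mem)

lemma prod_mem: "(\<And>i. i \<in> I \<Longrightarrow> f i \<in> S) \<Longrightarrow> prod f I \<in> S"
  by (induction I rule: infinite_finite_induct) (auto intro: one_mem mult_mem)

lemma of_nat_mem: "of_nat n \<in> S"
  by (induction n) (auto intro: zero_mem one_mem add_mem)

lemma of_int_mem: "of_int n \<in> S"
  by (cases n) (auto intro: of_nat_mem minus_mem simp del: of_nat_Suc)

lemma Ints_subset: "\<int> \<subseteq> S"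
  by (auto elim!: Ints_cases intro: of_int_mem)

lemmas mem_intros = zero_mem one_mem minus_mem add_mem diff_mem mult_mem power_mem sum_mem
  prod_mem of_nat_mem of_int_mem

end

lemma coeff_mem: "f \<in> polys_over S \<Longrightarrow> coeff f i \<in> S"
  by (simp add: polys_over_def)

lemma polys_over_mono: "S \<subseteq> T \<Longrightarrow> polys_over S \<subseteq> polys_over T"
  by (auto simp: polys_over_def)

lemma pCons_mem_polys_over_iff: "pCons c f \<in> polys_over S \<longleftrightarrow> c \<in> S \<and> f \<in> polys_over S"
  by (force simp: polys_over_def coeff_pCons split: nat.splits)

lemma poly_eq_sum_lessThan:
  fixes x :: "'a::comm_ring_1"
  assumes "degree g < n"
  shows "poly g x = (\<Sum>i<n. coeff g i * x ^ i)"
  unfolding poly_altdef using assms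
  by (intro sum.mono_neutral_left) (auto simp: coeff_eq_0 not_le)

lemma monic_monom_minus_const:
  fixes c :: "'a::comm_ring_1"
  assumes "n > 0"
  shows degree_monom_minus_const: "degree (monom 1 n - [:c:]) = n"
    and lead_coeff_monom_minus_const: "lead_coeff (monom 1 n - [:c:]) = 1"
proof -
  have coeff: "coeff (monom 1 n - [:c:]) k = (if k = n then 1 else if k = 0 then - c else 0)" for k
    using assms by (auto simp: coeff_pCons split: nat.splits)
  show degree: "degree (monom 1 n - [:c:]) = n"
    by (intro antisym degree_le le_degree) (simp_all add: coeff del: coeff_diff)
  show "lead_coeff (monom 1 n - [:c:]) = 1" unfolding degree by (simp add: coeff del: coeff_diff)
qed

context subring_set
begin

lemma poly_mem: "f \<in> polys_over S \<Longrightarrow> a \<in> S \<Longrightarrow> poly f a \<in> S"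
  unfolding poly_altdef by (intro mem_intros coeff_mem)

lemma subring_set_polys_over: "subring_set (polys_over S)"
  by unfold_locales
    (auto simp: polys_over_def coeff_mult one_pCons coeff_pCons split: nat.splits
      intro!: mem_intros)

lemma const_mem: "c \<in> S \<Longrightarrow> [:c:] \<in> polys_over S"
  by (simp add: pCons_mem_polys_over_iff) (simp add: polys_over_def zero_mem)

lemma linear_mem: "a \<in> S \<Longrightarrow> b \<in> S \<Longrightarrow> [:a, b:] \<in> polys_over S"
  using const_mem by (simp add: pCons_mem_polys_over_iff)

lemma monom_mem: "c \<in> S \<Longrightarrow> monom c n \<in> polys_over S"
  by (auto simp: polys_over_def zero_mem)

lemma monom_minus_const_mem: "c \<in> S \<Longrightarrow> monom 1 n - [:c:] \<in> polys_over S"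
  by (intro subring_set.diff_mem[OF subring_set_polys_over] monom_mem const_mem one_mem)

lemma smult_mem: "c \<in> S \<Longrightarrow> f \<in> polys_over S \<Longrightarrow> smult c f \<in> polys_over S"
  by (auto simp: polys_over_def mult_mem)

lemma pcompose_mem: "f \<in> polys_over S \<Longrightarrow> g \<in> polys_over S \<Longrightarrow> pcompose f g \<in> polys_over S"
  unfolding polys_over_def mem_Collect_eq
  by (intro allI coeff_pcompose_semiring_closed) (simp_all add: zero_mem add_mem mult_mem)

lemma division_by_monic:
  assumes m: "m \<in> polys_over S" "lead_coeff m = 1" "degree m > 0" and f: "f \<in> polys_over S"
  obtains q r where "q \<in> polys_over S" "r \<in> polys_over S" "f = q * m + r" "degree r < degree m"
proof -
  interpret P: subring_set "polys_over S" by (rule subring_set_polys_over)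
  have "\<exists>q\<in>polys_over S. \<exists>r\<in>polys_over S. f = q * m + r \<and> degree r < degree m"
    using f
  proof (induction f rule: pCons_induct)
    case 0
    show ?case using m by (intro bexI[of _ 0]) (auto intro: P.zero_mem)
  next
    case (pCons a f)
    then obtain q r where qr: "q \<in> polys_over S" "r \<in> polys_over S" "f = q * m + r"
        "degree r < degree m" and a: "a \<in> S"
      by (auto simp: pCons_mem_polys_over_iff)
    define c where "c = coeff (pCons a r) (degree m)"
    define s where "s = pCons a r - smult c m"
    have r: "pCons a r \<in> polys_over S" using a qr by (simp add: pCons_mem_polys_over_iff)
    then have c: "c \<in> S" unfolding c_def by (rule coeff_mem)
    have "coeff s k = 0" if "degree m \<le> k" for k
    proof (cases "k = degree m")
      case False
      then have "coeff (pCons a r) k = 0"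
        using that qr(4) by (simp add: coeff_pCons coeff_eq_0 split: nat.splits)
      with False that show ?thesis by (simp add: s_def coeff_eq_0)
    qed (use m in \<open>simp add: s_def c_def\<close>)
    then have "degree s < degree m" using m(3) by (intro degree_lessI) auto
    moreover have "pCons a f = pCons c q * m + s"
      using qr by (simp add: s_def)
    moreover have "s \<in> polys_over S" unfolding s_def by (intro P.diff_mem smult_mem r c m)
    moreover have "pCons c q \<in> polys_over S" using c qr by (simp add: pCons_mem_polys_over_iff)
    ultimately show ?case by blast
  qed
  with that show ?thesis by blast
qed

lemma linear_factor:
  assumes f: "f \<in> polys_over S" and a: "a \<in> S" "poly f a = 0"
  obtains q where "q \<in> polys_over S" "f = q * [:- a, 1:]"
proof -
  have "[:- a, 1:] \<in> polys_over S" by (intro linear_mem minus_mem one_mem a)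
  then obtain q r where qr: "q \<in> polys_over S" "f = q * [:- a, 1:] + r"
      and "degree r < degree [:- a, 1:]"
    by (rule division_by_monic[OF _ _ _ f]) simp_all
  then obtain c where "r = [:c:]" by (auto elim: degree_eq_zeroE)
  then have "r = 0" using a(2) qr(2) by simp
  with qr that show ?thesis by simp
qed

lemma base_subset_ring_adjoin: "S \<subseteq> ring_adjoin S a"
proof
  fix c assume "c \<in> S"
  then show "c \<in> ring_adjoin S a"
    unfolding ring_adjoin_def by (intro CollectI exI[of _ "[:c:]"]) (auto intro: const_mem)
qed

lemma gen_mem_ring_adjoin: "a \<in> ring_adjoin S a"
  unfolding ring_adjoin_def
  by (intro CollectI exI[of _ "[:0, 1:]"]) (auto intro: linear_mem zero_mem one_mem)

lemma subring_set_ring_adjoin: "subring_set (ring_adjoin S a)"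
proof -
  interpret P: subring_set "polys_over S" by (rule subring_set_polys_over)
  show ?thesis
  proof
    show "1 \<in> ring_adjoin S a" using base_subset_ring_adjoin one_mem by blast
  next
    fix x y assume "x \<in> ring_adjoin S a" "y \<in> ring_adjoin S a"
    then obtain f g where fg: "f \<in> polys_over S" "g \<in> polys_over S" "x = poly f a" "y = poly g a"
      by (auto simp: ring_adjoin_def)
    have "x - y = poly (f - g) a" "x * y = poly (f * g) a" using fg by simp_all
    with fg show "x - y \<in> ring_adjoin S a" "x * y \<in> ring_adjoin S a"
      unfolding ring_adjoin_def using P.diff_mem P.mult_mem by blast+
  qed
qed

lemma ring_adjoin_subset:
  assumes "B \<subseteq> S" "a \<in> S" shows "ring_adjoin B a \<subseteq> S"
  using assms polys_over_mono[of B S] by (auto simp: ring_adjoin_def intro: poly_mem)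

lemma ring_adjoin_reduced:
  assumes m: "m \<in> polys_over S" "lead_coeff m = 1" "degree m > 0" "poly m a = 0"
    and x: "x \<in> ring_adjoin S a"
  obtains r where "r \<in> polys_over S" "degree r < degree m" "x = poly r a"
proof -
  from x obtain f where f: "f \<in> polys_over S" "x = poly f a" by (auto simp: ring_adjoin_def)
  obtain q r where "r \<in> polys_over S" "f = q * m + r" "degree r < degree m"
    using division_by_monic[OF m(1-3) f(1)] by blast
  with m f that show ?thesis by auto
qed

lemma freshmans_dream:
  assumes p: "prime p" and xy: "x \<in> S" "y \<in> S"
  obtains w where "w \<in> S" "(x + y) ^ p = x ^ p + y ^ p + of_nat p * w"
proof
  define w where "w = (\<Sum>k\<in>{1..<p}. of_nat ((p choose k) div p) * x ^ k * y ^ (p - k))"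
  show "w \<in> S" unfolding w_def using xy by (intro mem_intros)
  have "p > 0" using p by (rule prime_gt_0_nat)
  have "(x + y) ^ p = (\<Sum>k<Suc p. of_nat (p choose k) * x ^ k * y ^ (p - k))"
    by (simp add: binomial_ring lessThan_Suc_atMost)
  also have "\<dots> = y ^ p + (\<Sum>k\<in>{1..<p}. of_nat (p choose k) * x ^ k * y ^ (p - k)) + x ^ p"
    using \<open>p > 0\<close> by (simp add: sum.atLeast_Suc_lessThan atLeast0LessThan[symmetric])
  also have "(\<Sum>k\<in>{1..<p}. of_nat (p choose k) * x ^ k * y ^ (p - k)) = of_nat p * w"
    unfolding w_def sum_distrib_left
  proof (intro sum.cong refl)
    fix k assume "k \<in> {1..<p}"
    then have "p dvd (p choose k)" using p by (intro dvd_choose_prime) auto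
    then have "(of_nat (p choose k) :: 'a) = of_nat p * of_nat ((p choose k) div p)"
      by (metis dvd_mult_div_cancel of_nat_mult)
    then show "of_nat (p choose k) * x ^ k * y ^ (p - k) =
      of_nat p * (of_nat ((p choose k) div p) * x ^ k * y ^ (p - k))" by (simp add: mult.assoc)
  qed
  finally show "(x + y) ^ p = x ^ p + y ^ p + of_nat p * w" by (simp add: add_ac)
qed

end

interpretation Ints: subring_set "\<int> :: 'a::comm_ring_1 set"
  by unfold_locales auto

locale subring_of_field = subring_set S for S :: "'a::field set"

locale subfield_set = subring_of_field +
  assumes inverse_mem: "x \<in> S \<Longrightarrow> inverse x \<in> S"
begin

lemma divide_mem: "x \<in> S \<Longrightarrow> y \<in> S \<Longrightarrow> x / y \<in> S"
  unfolding divide_inverse by (intro mult_mem inverse_mem)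

end

definition fraction_field :: "'a::field set \<Rightarrow> 'a set" where
  "fraction_field S = {a / b | a b. a \<in> S \<and> b \<in> S}"

lemma fraction_field_subset: "subfield_set F \<Longrightarrow> S \<subseteq> F \<Longrightarrow> fraction_field S \<subseteq> F"
  by (auto simp: fraction_field_def intro: subfield_set.divide_mem)

lemma fraction_field_mono: "S \<subseteq> T \<Longrightarrow> fraction_field S \<subseteq> fraction_field T"
  unfolding fraction_field_def by blast

lemma fraction_field_Ints: "fraction_field \<int> = (\<rat> :: 'a::field_char_0 set)"
proof
  show "fraction_field \<int> \<subseteq> (\<rat> :: 'a set)"
    using Ints_subset_Rats by (auto simp: fraction_field_def intro!: Rats_divide)
  show "(\<rat> :: 'a set) \<subseteq> fraction_field \<int>"
  proof
    fix x :: 'a assume "x \<in> \<rat>"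
    then obtain a b where "x = of_int a / of_int b" by (rule Rats_cases')
    then show "x \<in> fraction_field \<int>"
      unfolding fraction_field_def using Ints_of_int by blast
  qed
qed

context subring_of_field
begin

lemma divide_mem_fraction_field: "x \<in> S \<Longrightarrow> y \<in> S \<Longrightarrow> x / y \<in> fraction_field S"
  unfolding fraction_field_def by blast

lemma subset_fraction_field: "S \<subseteq> fraction_field S"
  using divide_mem_fraction_field[OF _ one_mem] by auto

lemma subfield_set_fraction_field: "subfield_set (fraction_field S)"
proof
  show "1 \<in> fraction_field S" using subset_fraction_field one_mem by blast
next
  fix x y assume "x \<in> fraction_field S" "y \<in> fraction_field S"
  then obtain a b c d where S: "a \<in> S" "b \<in> S" "c \<in> S" "d \<in> S" and xy: "x = a / b" "y = c / d"
    unfolding fraction_field_def by blast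
  show "x - y \<in> fraction_field S"
  proof (cases "b = 0 \<or> d = 0")
    case True
    then have "x - y = a / b \<or> x - y = (- c) / d" using xy by auto
    then show ?thesis using S minus_mem divide_mem_fraction_field by metis
  next
    case False
    then have "x - y = (a * d - c * b) / (b * d)" using xy by (simp add: diff_frac_eq)
    then show ?thesis using S by (simp add: divide_mem_fraction_field mem_intros)
  qed
  have "x * y = (a * c) / (b * d)" using xy by simp
  then show "x * y \<in> fraction_field S" using S by (simp only: divide_mem_fraction_field mult_mem)
next
  fix x assume "x \<in> fraction_field S"
  then show "inverse x \<in> fraction_field S" by (fastforce simp: fraction_field_def)
qed

lemma clear_denominators:
  assumes "f \<in> polys_over (fraction_field S)"
  obtains d where "d \<in> S" "d \<noteq> 0" "smult d f \<in> polys_over S"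
proof -
  have "\<exists>d\<in>S. d \<noteq> 0 \<and> smult d f \<in> polys_over S"
    using assms
  proof (induction f rule: pCons_induct)
    case 0
    show ?case by (intro bexI[of _ 1]) (auto simp: polys_over_def zero_mem one_mem)
  next
    case (pCons x f)
    then obtain d where d: "d \<in> S" "d \<noteq> 0" "smult d f \<in> polys_over S" and "x \<in> fraction_field S"
      by (auto simp: pCons_mem_polys_over_iff)
    then obtain a b where ab: "a \<in> S" "b \<in> S" "b \<noteq> 0" "x = a / b"
      using zero_mem one_mem unfolding fraction_field_def by (cases "x = 0") fastforce+
    have "smult (b * d) (pCons x f) = pCons (d * a) (smult b (smult d f))" using ab by simp
    also have "\<dots> \<in> polys_over S"
      using d ab by (simp only: pCons_mem_polys_over_iff smult_mem mult_mem)
    finally show ?case using d ab by (intro bexI[of _ "b * d"]) (auto intro: mult_mem)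
  qed
  with that show ?thesis by blast
qed

end

section \<open>Minimal polynomials\<close>

definition min_poly_over :: "'a::field set \<Rightarrow> 'a \<Rightarrow> 'a poly \<Rightarrow> bool" where
  "min_poly_over F a m \<longleftrightarrow> m \<in> polys_over F \<and> lead_coeff m = 1 \<and> poly m a = 0 \<and>
     (\<forall>f\<in>polys_over F. poly f a = 0 \<longrightarrow> degree f < degree m \<longrightarrow> f = 0)"

lemma min_poly_overD:
  assumes "min_poly_over F a m"
  shows "m \<in> polys_over F" "lead_coeff m = 1" "poly m a = 0"
    and "f \<in> polys_over F \<Longrightarrow> poly f a = 0 \<Longrightarrow> degree f < degree m \<Longrightarrow> f = 0"
  using assms by (auto simp: min_poly_over_def)

lemma monic_root_imp_degree_pos:
  assumes "lead_coeff m = 1" "poly m a = (0 :: 'a::field)" shows "degree m > 0"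
proof (rule ccontr)
  assume "\<not> degree m > 0"
  then obtain c where "m = [:c:]" by (metis degree_eq_zeroE gr0I)
  with assms show False by simp
qed

context subring_of_field
begin

lemma min_poly_dvd:
  assumes m: "min_poly_over S a m" and f: "f \<in> polys_over S" "poly f a = 0"
  obtains q where "q \<in> polys_over S" "f = q * m"
proof -
  note m = min_poly_overD[OF m]
  obtain q r where qr: "q \<in> polys_over S" "r \<in> polys_over S" "f = q * m + r" "degree r < degree m"
    using division_by_monic[OF m(1,2) monic_root_imp_degree_pos[OF m(2,3)] f(1)] by blast
  then have "r = 0" using m(3) f(2) by (intro m(4)) auto
  with qr that show ?thesis by simp
qed

lemma min_poly_conjugate_root:
  assumes "min_poly_over S a m" "poly m b = 0" "f \<in> polys_over S" "poly f a = 0"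
  shows "poly f b = 0"
  using min_poly_dvd[OF assms(1,3,4)] assms(2) by (metis mult_zero_right poly_mult)

lemma polys_over_if_poly_mem_ring_adjoin:
  assumes M: "min_poly_over (fraction_field S) a m" "m \<in> polys_over S"
    and g: "g \<in> polys_over (fraction_field S)" "degree g < degree m" "poly g a \<in> ring_adjoin S a"
  shows "g \<in> polys_over S"
proof -
  note m = min_poly_overD[OF M(1)]
  obtain h where h: "h \<in> polys_over S" "degree h < degree m" "poly g a = poly h a"
    using ring_adjoin_reduced[OF M(2) m(2) monic_root_imp_degree_pos[OF m(2,3)] m(3) g(3)] by blast
  interpret F: subfield_set "fraction_field S" by (rule subfield_set_fraction_field)
  interpret P: subring_set "polys_over (fraction_field S)" by (rule F.subring_set_polys_over)
  have "g - h = 0"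
  proof (rule m(4))
    show "g - h \<in> polys_over (fraction_field S)"
      using g h polys_over_mono[OF subset_fraction_field] by (intro P.diff_mem) auto
    show "degree (g - h) < degree m" using g h by (intro degree_diff_less)
  qed (use h in simp)
  with h show ?thesis by simp
qed

end

lemma (in subfield_set) exists_min_poly:
  assumes "f \<in> polys_over S" "f \<noteq> 0" "poly f a = 0"
  obtains m where "min_poly_over S a m"
proof -
  define annihilates where
    "annihilates = (\<lambda>g. g \<in> polys_over S \<and> g \<noteq> 0 \<and> poly g a = 0)"
  obtain g where g: "annihilates g" and least: "\<And>h. annihilates h \<Longrightarrow> degree g \<le> degree h"
    using ex_has_least_nat[of annihilates f degree] assms unfolding annihilates_def by blast
  define m where "m = smult (inverse (lead_coeff g)) g"
  have "lead_coeff g \<noteq> 0" using g by (simp add: annihilates_def)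
  then have "m \<in> polys_over S" "lead_coeff m = 1" "poly m a = 0" "degree m = degree g"
    using g by (auto simp: m_def annihilates_def coeff_mem intro!: smult_mem inverse_mem)
  moreover have "h = 0" if "h \<in> polys_over S" "poly h a = 0" "degree h < degree m" for h
    using least[of h] that \<open>degree m = degree g\<close> unfolding annihilates_def by force
  ultimately show ?thesis using that unfolding min_poly_over_def by blast
qed

section \<open>Algebraic integers\<close>

global_interpretation int_module: Modules.module "\<lambda>k x. of_int k * (x :: 'a::comm_ring_1)"
  defines int_span = int_module.span
  by unfold_locales (simp_all add: algebra_simps)

lemma int_span_induct [consumes 1, case_names zero step]:
  assumes "x \<in> int_span G" "P 0" "\<And>c g y. g \<in> G \<Longrightarrow> P y \<Longrightarrow> P (of_int c * g + y)"
  shows "P x"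
  using assms by (rule int_module.span_induct_alt)

lemma int_span_times:
  assumes "x \<in> int_span A" "y \<in> int_span B"
  shows "x * y \<in> int_span ((\<lambda>(a, b). a * b) ` (A \<times> B))" (is "_ \<in> int_span ?AB")
  using assms(1)
proof (induction x rule: int_span_induct)
  case zero
  show ?case by (simp add: int_module.span_zero)
next
  case (step c a x)
  have "a * y \<in> int_span ?AB"
    using assms(2)
  proof (induction y rule: int_span_induct)
    case (step d b y)
    have "a * b \<in> int_span ?AB" using step.hyps \<open>a \<in> A\<close> by (auto intro: int_module.span_base)
    then have "of_int d * (a * b) + a * y \<in> int_span ?AB"
      by (intro int_module.span_add int_module.span_scale step.IH)
    then show ?case by (simp add: algebra_simps)
  qed (simp add: int_module.span_zero)
  then have "of_int c * (a * y) + x * y \<in> int_span ?AB"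
    by (intro int_module.span_add int_module.span_scale step.IH)
  then show ?case by (simp add: algebra_simps)
qed

lemma poly_mem_int_span_powers:
  assumes f: "f \<in> polys_over \<int>" "degree f < n"
  shows "poly f x \<in> int_span ((^) x ` {..<n})"
  unfolding poly_eq_sum_lessThan[OF f(2)]
proof (rule int_module.span_sum)
  fix i assume "i \<in> {..<n}"
  then have "x ^ i \<in> int_span ((^) x ` {..<n})" by (intro int_module.span_base imageI)
  moreover obtain c where "coeff f i = of_int c" using coeff_mem[OF f(1)] by (rule Ints_cases)
  ultimately show "coeff f i * x ^ i \<in> int_span ((^) x ` {..<n})"
    by (simp add: int_module.span_scale)
qed

text \<open>The determinant trick: a generating family of the module is an eigenvector, with eigenvalue
  \<open>x\<close>, of the integer matrix that describes multiplication by \<open>x\<close>.\<close>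

lemma algebraic_int_if_stabilizes_int_span:
  fixes x :: "'a::field_char_0"
  assumes fin: "finite G" and nz: "h \<in> G" "h \<noteq> 0"
    and stable: "\<And>g. g \<in> G \<Longrightarrow> x * g \<in> int_span G"
  shows "algebraic_int x"
proof -
  define n where "n = card G"
  obtain e where e: "bij_betw e {..<n} G"
    using ex_bij_betw_nat_finite[OF fin] by (auto simp: atLeast0LessThan n_def)
  have "\<exists>u. x * e i = (\<Sum>j<n. of_int (u j) * e j)" if "i < n" for i
  proof -
    have "x * e i \<in> int_span G" using that e by (intro stable) (auto simp: bij_betw_def)
    then obtain u where "x * e i = (\<Sum>g\<in>G. of_int (u g) * g)"
      unfolding int_module.span_finite[OF fin] by blast
    then show ?thesis
      using sum.reindex_bij_betw[OF e, of "\<lambda>g. of_int (u g) * g"]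
      by (intro exI[of _ "u \<circ> e"]) simp
  qed
  then obtain a where a: "\<And>i. i < n \<Longrightarrow> x * e i = (\<Sum>j<n. of_int (a i j) * e j)" by metis
  define A :: "int mat" where "A = mat n n (\<lambda>(i, j). a i j)"
  have A: "A \<in> carrier_mat n n" by (simp add: A_def)
  let ?A = "map_mat (of_int :: int \<Rightarrow> 'a) A"
  have "eigenvector ?A (vec n e) x"
    unfolding eigenvector_def
  proof (intro conjI)
    show "vec n e \<in> carrier_vec (dim_row ?A)" using A by simp
    show "vec n e \<noteq> 0\<^sub>v (dim_row ?A)"
      using nz e A by (force simp: vec_eq_iff bij_betw_def)
    show "?A *\<^sub>v vec n e = x \<cdot>\<^sub>v vec n e"
      using A a by (intro eq_vecI) (auto simp: A_def scalar_prod_def atLeast0LessThan)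
  qed
  then have "poly (char_poly ?A) x = 0"
    using eigenvalue_root_char_poly[of ?A n x] A by (auto simp: eigenvalue_def)
  then have "poly (map_poly of_int (char_poly A)) x = 0"
    by (simp add: of_int_hom.char_poly_hom[OF A])
  moreover have "lead_coeff (char_poly A) = 1" using degree_monic_char_poly[OF A] by simp
  ultimately show ?thesis by (auto simp: algebraic_int_altdef_ipoly)
qed

lemma algebraic_int_powers_mem_int_span:
  assumes "algebraic_int (x :: 'a::field_char_0)"
  obtains n where "n > 0" "\<And>k. x ^ k \<in> int_span ((^) x ` {..<n})"
proof -
  from assms obtain m where m: "m \<in> polys_over \<int>" "lead_coeff m = 1" "poly m x = 0"
    by (auto elim: algebraic_int.cases simp: polys_over_def)
  let ?G = "(^) x ` {..<degree m}"
  have pos: "degree m > 0" using m by (intro monic_root_imp_degree_pos)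
  have "x ^ k \<in> int_span ?G" for k
  proof -
    have "x ^ k \<in> ring_adjoin \<int> x"
      using subring_set.power_mem[OF Ints.subring_set_ring_adjoin Ints.gen_mem_ring_adjoin] .
    then obtain r where r: "r \<in> polys_over \<int>" "degree r < degree m" "x ^ k = poly r x"
      by (rule Ints.ring_adjoin_reduced[OF m(1,2) pos m(3)])
    then show ?thesis by (simp add: poly_mem_int_span_powers)
  qed
  with pos that show ?thesis by blast
qed

lemma
  fixes x y :: "'a::field_char_0"
  assumes "algebraic_int x" "algebraic_int y"
  shows algebraic_int_plus: "algebraic_int (x + y)" and algebraic_int_times: "algebraic_int (x * y)"
proof -
  obtain n where n: "n > 0" "\<And>i. x ^ i \<in> int_span ((^) x ` {..<n})"
    using algebraic_int_powers_mem_int_span[OF assms(1)] by blast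
  obtain m where m: "m > 0" "\<And>j. y ^ j \<in> int_span ((^) y ` {..<m})"
    using algebraic_int_powers_mem_int_span[OF assms(2)] by blast
  define G where "G = (\<lambda>(a, b). a * b) ` ((^) x ` {..<n} \<times> (^) y ` {..<m})"
  have mem: "x ^ i * y ^ j \<in> int_span G" for i j
    unfolding G_def by (intro int_span_times n m)
  have fin: "finite G" by (simp add: G_def)
  have "1 = x ^ 0 * y ^ 0" by simp
  also have "\<dots> \<in> G" using n(1) m(1) unfolding G_def by blast
  finally have "1 \<in> G" .
  have "(x + y) * g \<in> int_span G \<and> (x * y) * g \<in> int_span G" if g: "g \<in> G" for g
  proof -
    obtain i j where g: "g = x ^ i * y ^ j" using g by (auto simp: G_def)
    have "(x + y) * g = x ^ Suc i * y ^ j + x ^ i * y ^ Suc j" "(x * y) * g = x ^ Suc i * y ^ Suc j"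
      by (simp_all add: g algebra_simps)
    then show ?thesis using mem int_module.span_add by metis
  qed
  then show "algebraic_int (x + y)" "algebraic_int (x * y)"
    by (auto intro: algebraic_int_if_stabilizes_int_span[OF fin \<open>1 \<in> G\<close>])
qed

interpretation algebraic_int: subring_of_field "{x :: 'a::field_char_0. algebraic_int x}"
proof
  fix x y :: 'a
  assume xy: "x \<in> {x. algebraic_int x}" "y \<in> {x. algebraic_int x}"
  then show "x * y \<in> {x. algebraic_int x}" by (simp add: algebraic_int_times)
  show "x - y \<in> {x. algebraic_int x}" using algebraic_int_plus[of x "- y"] xy by simp
qed simp

lemmas algebraic_int_intros = algebraic_int.mem_intros[unfolded mem_Collect_eq]

lemma algebraic_int_if_power:
  assumes "algebraic_int (x ^ n)" "n > 0" shows "algebraic_int (x :: 'a::field_char_0)"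
  by (rule algebraic_int_root[OF assms(1), of "monom 1 n"])
    (use assms(2) in \<open>auto simp: poly_monom degree_monom_eq\<close>)

lemma algebraic_int_conjugate:
  fixes g :: "'a::field_char_0 poly"
  assumes F: "subring_of_field F" and m: "min_poly_over F a m" "poly m b = 0"
    and g: "g \<in> polys_over F" "algebraic_int (poly g a)"
  shows "algebraic_int (poly g b)"
proof -
  interpret subring_of_field F by (rule F)
  obtain h where h: "h \<in> polys_over \<int>" "lead_coeff h = 1" "poly h (poly g a) = 0"
    using g(2) by (auto elim: algebraic_int.cases simp: polys_over_def)
  have "pcompose h g \<in> polys_over F"
    using polys_over_mono[OF Ints_subset] h g by (intro pcompose_mem) auto
  then have "poly (pcompose h g) b = 0"
    using h by (intro min_poly_conjugate_root[OF m]) (simp_all add: poly_pcompose)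
  with h show ?thesis
    by (intro algebraic_int.intros[of h]) (auto simp: poly_pcompose polys_over_def)
qed

lemma int_multiple_of_nonzero_root:
  fixes x :: "'a::field_char_0"
  assumes "f \<noteq> 0" "f \<in> polys_over \<int>" "poly f x = 0" "x \<noteq> 0"
  obtains q n where "q \<in> polys_over \<int>" "n \<noteq> 0" "x * poly q x = of_int n"
proof -
  have "\<exists>q\<in>polys_over \<int>. \<exists>n. n \<noteq> 0 \<and> x * poly q x = of_int n"
    using assms
  proof (induction f rule: pCons_induct)
    case (pCons a f)
    show ?case
    proof (cases "a = 0")
      case True
      with pCons show ?thesis by (auto simp: pCons_mem_polys_over_iff)
    next
      case False
      obtain k where k: "a = of_int k"
        using pCons.prems(2) by (auto simp: pCons_mem_polys_over_iff elim: Ints_cases)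
      have "x * poly f x = of_int (- k)"
        using pCons.prems(3) k by (simp add: eq_neg_iff_add_eq_0 add.commute)
      with k False pCons.prems(2) show ?thesis
        by (intro bexI[of _ f] exI[of _ "- k"]) (auto simp: pCons_mem_polys_over_iff)
    qed
  qed simp
  with that show ?thesis by blast
qed

locale integral_subring = subring_of_field S for S :: "'a::field_char_0 set" +
  assumes algebraic_int: "x \<in> S \<Longrightarrow> algebraic_int x"

interpretation Ints: integral_subring "\<int> :: 'a::field_char_0 set"
  by unfold_locales (rule int_imp_algebraic_int)

context integral_subring
begin

lemma dvd_positive_int:
  assumes "x \<in> S" "x \<noteq> 0"
  obtains y and N :: int where "y \<in> S" "N > 0" "x * y = of_int N"
proof -
  obtain f where f: "lead_coeff f = 1" "f \<in> polys_over \<int>" "poly f x = 0"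
    using algebraic_int[OF assms(1)] by (auto elim: algebraic_int.cases simp: polys_over_def)
  then have "f \<noteq> 0" by auto
  then obtain q n where q: "q \<in> polys_over \<int>" "n \<noteq> 0" "x * poly q x = of_int n"
    using int_multiple_of_nonzero_root[OF _ f(2,3) assms(2)] by blast
  have "poly q x \<in> S" using q(1) polys_over_mono[OF Ints_subset] assms by (intro poly_mem) auto
  then have "of_int (sgn n) * poly q x \<in> S" by (intro mult_mem of_int_mem)
  moreover have "x * (of_int (sgn n) * poly q x) = of_int \<bar>n\<bar>"
    using q(3) by (metis abs_sgn mult.commute mult.left_commute of_int_mult)
  ultimately show ?thesis using that q(2) by (metis zero_less_abs_iff)
qed

lemma fraction_field_int_denominator:
  assumes "x \<in> fraction_field S"
  obtains N :: int where "N > 0" "of_int N * x \<in> S"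
proof (cases "x = 0")
  case True
  with that[of 1] show ?thesis by (simp add: zero_mem)
next
  case False
  obtain a b where ab: "a \<in> S" "b \<in> S" "x = a / b" using assms by (auto simp: fraction_field_def)
  with False have "b \<noteq> 0" by auto
  then obtain y N where y: "y \<in> S" "N > 0" "b * y = of_int N" using dvd_positive_int ab(2) by blast
  have "of_int N * x = y * a" using ab \<open>b \<noteq> 0\<close> unfolding y(3)[symmetric] by simp
  then show ?thesis using that[OF y(2)] y(1) ab(1) by (simp add: mult_mem)
qed

lemma integral_subring_ring_adjoin:
  assumes "algebraic_int a" shows "integral_subring (ring_adjoin S a)"
proof -
  interpret A: subring_set "ring_adjoin S a" by (rule subring_set_ring_adjoin)
  show ?thesis
    using algebraic_int.ring_adjoin_subset[of S a] assms algebraic_int by unfold_locales auto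
qed

lemma fraction_field_ring_adjoin_reduced:
  assumes m: "m \<in> polys_over S" "lead_coeff m = 1" "poly m a = 0"
    and a: "algebraic_int a" and x: "x \<in> fraction_field (ring_adjoin S a)"
  obtains g where "g \<in> polys_over (fraction_field S)" "degree g < degree m" "x = poly g a"
proof -
  interpret A: integral_subring "ring_adjoin S a" by (rule integral_subring_ring_adjoin[OF a])
  obtain N :: int where N: "N > 0" "of_int N * x \<in> ring_adjoin S a"
    using x by (rule A.fraction_field_int_denominator)
  obtain r where r: "r \<in> polys_over S" "degree r < degree m" "of_int N * x = poly r a"
    by (rule ring_adjoin_reduced[OF m(1,2) monic_root_imp_degree_pos[OF m(2,3)] m(3) N(2)])
  define g where "g = smult (1 / of_int N) r"
  have "g \<in> polys_over (fraction_field S)"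
    unfolding g_def polys_over_def
    using coeff_mem[OF r(1)] divide_mem_fraction_field[OF _ of_int_mem] by simp
  moreover have "degree g < degree m" using r(2) N(1) by (simp add: g_def)
  moreover have "x = poly g a" using N(1) by (simp add: g_def flip: r(3))
  ultimately show ?thesis by (rule that)
qed

end

text \<open>In the expansion \<open>\<Sum>i<n. a i * \<theta> ^ i\<close> of a multiple of \<open>d\<close>, multiplication by \<open>\<theta> ^ (n - Suc k)\<close>
  makes all terms above the \<open>k\<close>-th divisible by \<open>\<theta> ^ n\<close>, hence by \<open>d\<close>.\<close>

lemma (in subring_of_field) eisenstein_coeffs_dvd:
  assumes \<theta>: "\<theta> \<in> S" "\<theta> ^ n / d \<in> S" and a: "\<And>i. i < n \<Longrightarrow> a i \<in> S"
    and total: "(\<Sum>i<n. a i * \<theta> ^ i) / d \<in> S"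
    and cancel: "\<And>i. i < n \<Longrightarrow> a i * \<theta> ^ (n - 1) / d \<in> S \<Longrightarrow> a i / d \<in> S"
    and k: "k < n"
  shows "a k / d \<in> S"
  using k
proof (induction k rule: less_induct)
  case (less k)
  define low where "low = (\<Sum>i<k. a i / d * \<theta> ^ i)"
  define high where "high = (\<Sum>i\<in>{Suc k..<n}. a i * \<theta> ^ (i - Suc k))"
  have low: "low \<in> S" unfolding low_def using less \<theta> by (intro mem_intros) auto
  have high: "high \<in> S" unfolding high_def using a \<theta> by (intro mem_intros) auto
  have "(\<Sum>i<n. a i * \<theta> ^ i) = (\<Sum>i<Suc k. a i * \<theta> ^ i) + (\<Sum>i\<in>{Suc k..<n}. a i * \<theta> ^ i)"
    using less.prems sum.atLeastLessThan_concat[of 0 "Suc k" n "\<lambda>i. a i * \<theta> ^ i"]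
    by (simp add: atLeast0LessThan)
  also have "(\<Sum>i\<in>{Suc k..<n}. a i * \<theta> ^ i) = \<theta> ^ Suc k * high"
    unfolding high_def sum_distrib_left
  proof (intro sum.cong refl)
    fix i assume "i \<in> {Suc k..<n}"
    then have "\<theta> ^ i = \<theta> ^ Suc k * \<theta> ^ (i - Suc k)" by (simp only: power_add[symmetric]) simp
    then show "a i * \<theta> ^ i = \<theta> ^ Suc k * (a i * \<theta> ^ (i - Suc k))" by simp
  qed
  finally have "(\<Sum>i<n. a i * \<theta> ^ i) / d = low + a k * \<theta> ^ k / d + \<theta> ^ Suc k * high / d"
    by (simp add: low_def sum_divide_distrib add_divide_distrib)
  then have "a k * \<theta> ^ k / d + \<theta> ^ Suc k * high / d = (\<Sum>i<n. a i * \<theta> ^ i) / d - low" by simp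
  then have "(a k * \<theta> ^ k / d + \<theta> ^ Suc k * high / d) * \<theta> ^ (n - Suc k) \<in> S"
    using total low \<theta>(1) by (simp only: mult_mem diff_mem power_mem)
  also have "(a k * \<theta> ^ k / d + \<theta> ^ Suc k * high / d) * \<theta> ^ (n - Suc k) =
      a k * (\<theta> ^ k * \<theta> ^ (n - Suc k)) / d + \<theta> ^ Suc k * \<theta> ^ (n - Suc k) / d * high"
    by (simp add: distrib_left distrib_right mult_ac)
  also have "\<theta> ^ k * \<theta> ^ (n - Suc k) = \<theta> ^ (n - 1)"
    using less.prems by (simp only: power_add[symmetric]) simp
  also have "\<theta> ^ Suc k * \<theta> ^ (n - Suc k) = \<theta> ^ n"
    using less.prems by (simp only: power_add[symmetric]) simp
  finally have "a k * \<theta> ^ (n - 1) / d + \<theta> ^ n / d * high - \<theta> ^ n / d * high \<in> S"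
    using \<theta>(2) high by (intro diff_mem mult_mem)
  then show ?case using cancel less.prems by simp
qed

section \<open>Ideals of subrings\<close>

lemma subring_on_simps [simp]:
  "carrier (subring_on S) = S" "x \<otimes>\<^bsub>subring_on S\<^esub> y = x * y" "x \<oplus>\<^bsub>subring_on S\<^esub> y = x + y"
  "\<one>\<^bsub>subring_on S\<^esub> = 1" "\<zero>\<^bsub>subring_on S\<^esub> = 0"
  by (simp_all add: subring_on_def ring_of_type_algebra_def)

lemma ideal_prod_mem: "x \<in> I \<Longrightarrow> y \<in> J \<Longrightarrow> x * y \<in> I \<cdot>\<^bsub>subring_on S\<^esub> J"
  using ideal_prod.prod[of x I y J "subring_on S"] by simp

lemma ideal_prod_subset:
  assumes prod: "\<And>x y. x \<in> I \<Longrightarrow> y \<in> J \<Longrightarrow> x * y \<in> T"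
    and sum: "\<And>x y. x \<in> T \<Longrightarrow> y \<in> T \<Longrightarrow> x + y \<in> T"
  shows "I \<cdot>\<^bsub>subring_on S\<^esub> J \<subseteq> T"
proof
  fix z assume "z \<in> I \<cdot>\<^bsub>subring_on S\<^esub> J"
  then show "z \<in> T" by (induction rule: ideal_prod.induct) (simp_all add: assms)
qed

context subring_set
begin

lemma cring_subring_on: "cring (subring_on S)"
proof (rule cringI)
  show "abelian_group (subring_on S)"
  proof (rule abelian_groupI)
    show "\<exists>y\<in>carrier (subring_on S). y \<oplus>\<^bsub>subring_on S\<^esub> x = \<zero>\<^bsub>subring_on S\<^esub>"
      if "x \<in> carrier (subring_on S)" for x
      using that by (intro bexI[of _ "- x"]) (auto intro: minus_mem)
  qed (auto intro: mem_intros)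
  show "comm_monoid (subring_on S)"
    by (rule comm_monoidI) (auto intro: mem_intros simp: mult_ac)
qed (auto simp: distrib_right)

lemma ring_subring_on: "ring (subring_on S)"
  using cring_subring_on by (rule cring.axioms)

lemma ideal_subring_onI:
  assumes "J \<subseteq> S" "0 \<in> J" "\<And>x y. x \<in> J \<Longrightarrow> y \<in> J \<Longrightarrow> x + y \<in> J"
    and mult: "\<And>r x. r \<in> S \<Longrightarrow> x \<in> J \<Longrightarrow> r * x \<in> J"
  shows "ideal J (subring_on S)"
proof (rule idealI[OF ring_subring_on])
  interpret ring "subring_on S" by (rule ring_subring_on)
  show "subgroup J (add_monoid (subring_on S))"
  proof (rule add.subgroupI)
    fix x assume x: "x \<in> J"
    then have "- x \<in> J" using mult[OF minus_mem[OF one_mem] x] by simp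
    moreover have "\<ominus>\<^bsub>subring_on S\<^esub> x = - x"
      using x assms \<open>- x \<in> J\<close> by (intro minus_equality) auto
    ultimately show "\<ominus>\<^bsub>subring_on S\<^esub> x \<in> J" by simp
  qed (use assms in auto)
  show "x \<otimes>\<^bsub>subring_on S\<^esub> a \<in> J" "a \<otimes>\<^bsub>subring_on S\<^esub> x \<in> J"
    if "a \<in> J" "x \<in> carrier (subring_on S)" for a x
    using mult[of x a] that by (simp_all add: mult.commute[of a x])
qed

lemma ideal_subring_onD:
  assumes "ideal J (subring_on S)"
  shows "J \<subseteq> S" "0 \<in> J" "x \<in> J \<Longrightarrow> y \<in> J \<Longrightarrow> x + y \<in> J" "r \<in> S \<Longrightarrow> x \<in> J \<Longrightarrow> r * x \<in> J"
    and "x \<in> J \<Longrightarrow> y \<in> J \<Longrightarrow> x - y \<in> J"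
proof -
  interpret ideal J "subring_on S" by fact
  show "J \<subseteq> S" using a_subset by simp
  show "0 \<in> J" using additive_subgroup.zero_closed[OF is_additive_subgroup] by simp
  show add: "x \<in> J \<Longrightarrow> y \<in> J \<Longrightarrow> x + y \<in> J" for x y
    using additive_subgroup.a_closed[OF is_additive_subgroup] by simp
  show mult: "r \<in> S \<Longrightarrow> x \<in> J \<Longrightarrow> r * x \<in> J" for r x using I_l_closed by simp
  show "x \<in> J \<Longrightarrow> y \<in> J \<Longrightarrow> x - y \<in> J"
    using add[OF _ mult[of "- 1"], of x y] by (simp add: minus_mem one_mem)
qed

lemma primeideal_subring_onD:
  assumes P: "primeideal P (subring_on S)"
  shows "ideal P (subring_on S)" "1 \<notin> P" "x \<in> S \<Longrightarrow> y \<in> S \<Longrightarrow> x * y \<in> P \<Longrightarrow> x \<in> P \<or> y \<in> P"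
proof -
  interpret P: primeideal P "subring_on S" by fact
  show "ideal P (subring_on S)" by (rule P.is_ideal)
  note D = ideal_subring_onD[OF P.is_ideal]
  show "1 \<notin> P"
  proof
    assume "1 \<in> P"
    then have "P = S" using D(1) D(4)[of _ 1] by auto
    with P.I_notcarr show False by simp
  qed
  show "x \<in> S \<Longrightarrow> y \<in> S \<Longrightarrow> x * y \<in> P \<Longrightarrow> x \<in> P \<or> y \<in> P" using P.I_prime[of x y] by simp
qed

lemma ideal_prod_subring_on:
  "ideal I (subring_on S) \<Longrightarrow> ideal J (subring_on S) \<Longrightarrow> ideal (I \<cdot>\<^bsub>subring_on S\<^esub> J) (subring_on S)"
  by (rule ring.ideal_prod_is_ideal[OF ring_subring_on])

lemma PIdl_subring_on: "PIdl\<^bsub>subring_on S\<^esub> a = {r * a | r. r \<in> S}"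
  by (simp add: cgenideal_def)

lemma ideal_PIdl_subring_on: "a \<in> S \<Longrightarrow> ideal (PIdl\<^bsub>subring_on S\<^esub> a) (subring_on S)"
  using cring.cgenideal_ideal[OF cring_subring_on] by simp

lemma PIdl_subset_iff:
  assumes J: "ideal J (subring_on S)" shows "PIdl\<^bsub>subring_on S\<^esub> a \<subseteq> J \<longleftrightarrow> a \<in> J"
proof
  have "1 * a \<in> PIdl\<^bsub>subring_on S\<^esub> a" unfolding PIdl_subring_on using one_mem by blast
  then show "PIdl\<^bsub>subring_on S\<^esub> a \<subseteq> J \<Longrightarrow> a \<in> J" by auto
qed (auto simp: PIdl_subring_on intro: ideal_subring_onD[OF J])

lemma PIdl_prod:
  assumes "a \<in> S" "b \<in> S"
  shows "(PIdl\<^bsub>subring_on S\<^esub> a) \<cdot>\<^bsub>subring_on S\<^esub> (PIdl\<^bsub>subring_on S\<^esub> b) = PIdl\<^bsub>subring_on S\<^esub> (a * b)"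
proof
  note ideals = assms[THEN ideal_PIdl_subring_on]
  have "x * y \<in> PIdl\<^bsub>subring_on S\<^esub> (a * b)"
    if "x \<in> PIdl\<^bsub>subring_on S\<^esub> a" "y \<in> PIdl\<^bsub>subring_on S\<^esub> b" for x y
  proof -
    obtain r s where "r \<in> S" "s \<in> S" "x = r * a" "y = s * b"
      using \<open>x \<in> _\<close> \<open>y \<in> _\<close> unfolding PIdl_subring_on by blast
    then have "x * y = (r * s) * (a * b)" "r * s \<in> S" by (simp_all add: mult_ac mult_mem)
    then show ?thesis unfolding PIdl_subring_on by blast
  qed
  then show "(PIdl\<^bsub>subring_on S\<^esub> a) \<cdot>\<^bsub>subring_on S\<^esub> (PIdl\<^bsub>subring_on S\<^esub> b) \<subseteq> PIdl\<^bsub>subring_on S\<^esub> (a * b)"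
    using ideal_subring_onD(3)[OF ideal_PIdl_subring_on] assms mult_mem
    by (intro ideal_prod_subset) blast+
  have "a * b \<in> (PIdl\<^bsub>subring_on S\<^esub> a) \<cdot>\<^bsub>subring_on S\<^esub> (PIdl\<^bsub>subring_on S\<^esub> b)"
    using ideals[THEN PIdl_subset_iff] by (intro ideal_prod_mem) blast+
  then show "PIdl\<^bsub>subring_on S\<^esub> (a * b) \<subseteq> (PIdl\<^bsub>subring_on S\<^esub> a) \<cdot>\<^bsub>subring_on S\<^esub> (PIdl\<^bsub>subring_on S\<^esub> b)"
    using ideals by (simp add: PIdl_subset_iff ideal_prod_subring_on)
qed

end

lemma domain_subring_on:
  fixes S :: "'a::idom set"
  assumes "subring_set S" shows "domain (subring_on S)"
  using subring_set.cring_subring_on[OF assms] by (simp add: domain_def domain_axioms_def)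

lemma ring_irreducible_imp_no_root:
  fixes S :: "'a::idom set"
  assumes S: "subring_set S"
    and irreducible: "ring_irreducible\<^bsub>subring_on (polys_over S)\<^esub> f"
    and f: "f \<in> polys_over S" "degree f > 1" "poly f a = 0"
  shows "a \<notin> S"
proof
  let ?P = "subring_on (polys_over S)"
  interpret subring_set S by (rule S)
  interpret P: domain ?P by (intro domain_subring_on subring_set_polys_over)
  assume a: "a \<in> S"
  then obtain q where q: "q \<in> polys_over S" "f = q * [:- a, 1:]"
    using linear_factor[OF f(1) _ f(3)] by blast
  have unit_degree: "degree u = 0" if unit: "u \<in> Units ?P" for u :: "'a poly"
  proof -
    obtain v where "u * v = 1" using unit by (auto simp: Units_def)
    moreover from this have "u \<noteq> 0" "v \<noteq> 0" by auto
    ultimately show ?thesis using degree_mult_eq[of u v] by simp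
  qed
  have "u \<in> Units ?P \<or> v \<in> Units ?P"
    if "u \<in> polys_over S" "v \<in> polys_over S" "f = u * v" for u v
    using f(1) that
    by (intro P.ring_irreducibleE(5)[OF _ irreducible]) (simp_all only: subring_on_simps)
  moreover have "[:- a, 1:] \<in> polys_over S" by (intro linear_mem minus_mem one_mem a)
  ultimately have "q \<in> Units ?P \<or> [:- a, 1:] \<in> Units ?P" using q by blast
  then have "degree q = 0 \<or> degree [:- a, 1:] = 0"
    using unit_degree by metis
  then have "degree q = 0" by simp
  then have "degree f \<le> 1" unfolding q(2) using degree_mult_le[of q "[:- a, 1:]"] by simp
  with f(2) show False by simp
qed

context subring_of_field
begin

lemma mem_PIdl_iff: "a \<noteq> 0 \<Longrightarrow> x \<in> PIdl\<^bsub>subring_on S\<^esub> a \<longleftrightarrow> x / a \<in> S"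
  by (auto simp: PIdl_subring_on) (metis nonzero_eq_divide_eq)

lemma squarefree_ideal_if_radical:
  assumes a: "a \<noteq> 0" and radical: "\<And>x. x \<in> S \<Longrightarrow> x\<^sup>2 / a \<in> S \<Longrightarrow> x / a \<in> S"
  shows "squarefree_ideal (subring_on S) (PIdl\<^bsub>subring_on S\<^esub> a)"
  unfolding squarefree_ideal_def ideal_dvd_def
proof (intro notI, elim exE conjE)
  fix P L
  let ?PP = "P \<cdot>\<^bsub>subring_on S\<^esub> P"
  assume P: "primeideal P (subring_on S)" and L: "ideal L (subring_on S)"
    and eq: "PIdl\<^bsub>subring_on S\<^esub> a = ?PP \<cdot>\<^bsub>subring_on S\<^esub> L"
  note P = primeideal_subring_onD[OF P] and LD = ideal_subring_onD[OF L]
  note PD = ideal_subring_onD[OF P(1)]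
  have dvd: "y * z / a \<in> S" if y: "y \<in> P" and z: "z \<in> L" for y z
  proof (rule radical)
    have "y \<in> S" "z \<in> S" using y z PD(1) LD(1) by auto
    then show "y * z \<in> S" by (rule mult_mem)
    have "y * y * z \<in> PIdl\<^bsub>subring_on S\<^esub> a" unfolding eq by (intro ideal_prod_mem y z)
    then have "y * y * z / a \<in> S" using a by (simp add: mem_PIdl_iff)
    then have "y * y * z / a * z \<in> S" using \<open>z \<in> S\<close> by (rule mult_mem)
    then show "(y * z)\<^sup>2 / a \<in> S" by (simp add: power2_eq_square mult_ac)
  qed
  have "w * z / a \<in> P" if w: "w \<in> ?PP" and z: "z \<in> L" for w z
  proof -
    have "?PP \<subseteq> {w. w * z / a \<in> P}"
    proof (rule ideal_prod_subset)
      fix x y assume "x \<in> P" "y \<in> P"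
      then have "(y * z / a) * x \<in> P" by (intro PD(4) dvd z)
      then show "x * y \<in> {w. w * z / a \<in> P}" by (simp add: mult_ac)
    qed (simp add: distrib_right add_divide_distrib PD(3))
    with w show ?thesis by blast
  qed
  then have "?PP \<cdot>\<^bsub>subring_on S\<^esub> L \<subseteq> {w. w / a \<in> P}"
    by (intro ideal_prod_subset) (simp_all add: add_divide_distrib PD(3))
  moreover have "a \<in> PIdl\<^bsub>subring_on S\<^esub> a" using a by (simp add: mem_PIdl_iff one_mem)
  ultimately have "a / a \<in> P" unfolding eq by blast
  with P(2) a show False by simp
qed

definition denominator_ideal :: "'a \<Rightarrow> 'a set" where
  "denominator_ideal c = {r \<in> S. r * c \<in> S}"

lemma ideal_denominator_ideal: "ideal (denominator_ideal c) (subring_on S)"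
  by (rule ideal_subring_onI)
    (auto simp: denominator_ideal_def distrib_right mult.assoc intro: mem_intros)

lemma denominator_ideal_subset_mult:
  assumes "x \<in> S" shows "denominator_ideal c \<subseteq> denominator_ideal (x * c)"
proof
  fix r assume "r \<in> denominator_ideal c"
  then have "r \<in> S" "x * (r * c) \<in> S" using assms by (auto simp: denominator_ideal_def mult_mem)
  then show "r \<in> denominator_ideal (x * c)" by (simp add: denominator_ideal_def mult.left_commute)
qed

lemma primeideal_maximal_denominator_ideal:
  assumes c: "c \<notin> S"
    and maximal: "\<And>x. x \<in> S \<Longrightarrow> x * c \<notin> S \<Longrightarrow> denominator_ideal (x * c) \<subseteq> denominator_ideal c"
  shows "primeideal (denominator_ideal c) (subring_on S)"
proof (rule primeidealI[OF ideal_denominator_ideal cring_subring_on])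
  have "1 \<in> S - denominator_ideal c" using c one_mem by (simp add: denominator_ideal_def)
  then show "carrier (subring_on S) \<noteq> denominator_ideal c" by auto
next
  fix x y assume "x \<in> carrier (subring_on S)" "y \<in> carrier (subring_on S)"
    and "x \<otimes>\<^bsub>subring_on S\<^esub> y \<in> denominator_ideal c"
  then have xy: "x \<in> S" "y \<in> S" "y * (x * c) \<in> S"
    by (simp_all add: denominator_ideal_def mult_ac)
  show "x \<in> denominator_ideal c \<or> y \<in> denominator_ideal c"
  proof (cases "x * c \<in> S")
    case False
    then show ?thesis using maximal[of x] xy by (auto simp: denominator_ideal_def)
  qed (use xy in \<open>simp add: denominator_ideal_def\<close>)
qed

definition colon_ideal :: "'a \<Rightarrow> 'a set \<Rightarrow> 'a set" where
  "colon_ideal a I = {y \<in> S. \<forall>x\<in>I. x * y / a \<in> S}"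

lemma ideal_colon_ideal: "ideal (colon_ideal a I) (subring_on S)"
proof (rule ideal_subring_onI)
  fix r y assume ry: "r \<in> S" "y \<in> colon_ideal a I"
  then have "r * (x * y / a) \<in> S" if "x \<in> I" for x
    using that by (intro mult_mem) (auto simp: colon_ideal_def)
  then show "r * y \<in> colon_ideal a I" using ry by (simp add: colon_ideal_def mult_mem mult_ac)
qed (auto simp: colon_ideal_def distrib_left add_divide_distrib intro: mem_intros)

lemma ideal_dvd_PIdlI:
  assumes I: "ideal I (subring_on S)" and a: "a \<noteq> 0" "a \<in> I \<cdot>\<^bsub>subring_on S\<^esub> colon_ideal a I"
  shows "ideal_dvd (subring_on S) I (PIdl\<^bsub>subring_on S\<^esub> a)"
  unfolding ideal_dvd_def
proof (intro exI conjI)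
  show "ideal (colon_ideal a I) (subring_on S)" by (rule ideal_colon_ideal)
  show "PIdl\<^bsub>subring_on S\<^esub> a = I \<cdot>\<^bsub>subring_on S\<^esub> colon_ideal a I"
  proof
    show "PIdl\<^bsub>subring_on S\<^esub> a \<subseteq> I \<cdot>\<^bsub>subring_on S\<^esub> colon_ideal a I"
      using a(2) I ideal_colon_ideal by (simp add: PIdl_subset_iff ideal_prod_subring_on)
    show "I \<cdot>\<^bsub>subring_on S\<^esub> colon_ideal a I \<subseteq> PIdl\<^bsub>subring_on S\<^esub> a"
      using a(1) by (intro ideal_prod_subset)
        (auto simp: mem_PIdl_iff colon_ideal_def add_divide_distrib intro: add_mem)
  qed
qed

end

section \<open>Maximal orders\<close>

locale maximal_order = integral_subring +
  assumes finitely_generated: "\<exists>G. finite G \<and> S = int_span G"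
    and integrally_closed: "x \<in> fraction_field S \<Longrightarrow> algebraic_int x \<Longrightarrow> x \<in> S"
begin

lemma finite_residues:
  fixes N :: int
  assumes "N > 0"
  obtains T where "finite T" "\<forall>x\<in>S. \<exists>t\<in>T. \<exists>s\<in>S. x = t + of_int N * s"
proof -
  obtain G where G: "finite G" "S = int_span G" using finitely_generated by blast
  define comb where "comb = (\<lambda>u. \<Sum>g\<in>G. of_int (u g) * g)"
  define T where "T = comb ` (G \<rightarrow>\<^sub>E {0..<N})"
  have S: "S = range comb" unfolding G(2) comb_def by (rule int_module.span_finite[OF G(1)])
  show ?thesis
  proof
    show "finite T" unfolding T_def using G(1) by (intro finite_imageI finite_PiE) auto
    show "\<forall>x\<in>S. \<exists>t\<in>T. \<exists>s\<in>S. x = t + of_int N * s"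
    proof
      fix x assume "x \<in> S"
      then obtain u where x: "x = comb u" unfolding S by blast
      define v where "v = restrict (\<lambda>g. u g mod N) G"
      have "x = comb v + of_int N * comb (\<lambda>g. u g div N)"
        unfolding x comb_def sum_distrib_left sum.distrib[symmetric]
      proof (intro sum.cong refl)
        fix g assume "g \<in> G"
        then have "of_int (u g) = (of_int (v g + N * (u g div N)) :: 'a)" by (simp add: v_def)
        then show "of_int (u g) * g = of_int (v g) * g + of_int N * (of_int (u g div N) * g)"
          by (simp add: algebra_simps)
      qed
      moreover have "comb v \<in> T" unfolding T_def v_def using assms by (intro imageI) auto
      ultimately show "\<exists>t\<in>T. \<exists>s\<in>S. x = t + of_int N * s" unfolding S by blast
    qed
  qed
qed

lemma ideal_contains_positive_int:
  assumes J: "ideal J (subring_on S)" and x: "x \<in> J" "x \<noteq> 0"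
  obtains N :: int where "N > 0" "of_int N \<in> J"
proof -
  note J = ideal_subring_onD[OF J]
  obtain y and N :: int where "y \<in> S" "N > 0" "x * y = of_int N"
    using dvd_positive_int x J(1) by blast
  then show ?thesis using that J(4)[of y x] x(1) by (simp add: mult.commute)
qed

lemma ideal_finitely_generated:
  assumes J: "ideal J (subring_on S)" and x: "x \<in> J" "x \<noteq> 0"
  obtains H where "finite H" "H \<subseteq> J" "J \<subseteq> int_span H"
proof -
  note JD = ideal_subring_onD[OF J]
  obtain N :: int where N: "N > 0" "of_int N \<in> J" by (rule ideal_contains_positive_int[OF J x])
  obtain T where T: "finite T" "\<forall>x\<in>S. \<exists>t\<in>T. \<exists>s\<in>S. x = t + of_int N * s"
    by (rule finite_residues[OF N(1)])
  obtain G where G: "finite G" "S = int_span G" using finitely_generated by blast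
  define NG where "NG = (\<lambda>(a, b). a * b) ` ({of_int N} \<times> G)"
  show ?thesis
  proof
    show "finite (NG \<union> (T \<inter> J))" using G(1) T(1) by (simp add: NG_def)
    have "G \<subseteq> S" unfolding G(2) by (rule int_module.span_superset)
    then show "NG \<union> (T \<inter> J) \<subseteq> J" using JD(4)[OF _ N(2)] by (auto simp: NG_def mult.commute)
    show "J \<subseteq> int_span (NG \<union> (T \<inter> J))"
    proof
      fix y assume y: "y \<in> J"
      then obtain t s where ts: "t \<in> T" "s \<in> S" "y = t + of_int N * s" using T(2) JD(1) by blast
      have "y - s * of_int N \<in> J" by (intro JD y ts N)
      then have "t \<in> int_span (NG \<union> (T \<inter> J))"
        using ts by (intro int_module.span_base) (simp add: mult.commute)
      moreover have "of_int N * s \<in> int_span NG"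
        unfolding NG_def using ts(2) G(2)
        by (intro int_span_times) (auto intro: int_module.span_base)
      then have "of_int N * s \<in> int_span (NG \<union> (T \<inter> J))"
        using int_module.span_mono[of NG "NG \<union> (T \<inter> J)"] by blast
      ultimately show "y \<in> int_span (NG \<union> (T \<inter> J))" unfolding ts(3) by (rule int_module.span_add)
    qed
  qed
qed

lemma stabilizes_ideal_imp_mem:
  assumes J: "ideal J (subring_on S)" and x: "x \<in> J" "x \<noteq> 0"
    and c: "c \<in> fraction_field S" and stable: "\<And>y. y \<in> J \<Longrightarrow> c * y \<in> J"
  shows "c \<in> S"
proof -
  obtain H where H: "finite H" "H \<subseteq> J" "J \<subseteq> int_span H"
    using ideal_finitely_generated[OF J x] by blast
  have "algebraic_int c"
  proof (rule algebraic_int_if_stabilizes_int_span[of "insert x H" x])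
    show "c * y \<in> int_span (insert x H)" if "y \<in> insert x H" for y
      using that stable[of y] x(1) H int_module.span_mono[of H "insert x H"] by blast
  qed (use H(1) x(2) in auto)
  then show ?thesis by (rule integrally_closed[OF c])
qed

lemma finite_ideals_containing_int:
  fixes N :: int
  assumes "N > 0" shows "finite {J. ideal J (subring_on S) \<and> of_int N \<in> J}"
proof -
  obtain T where T: "finite T" "\<forall>x\<in>S. \<exists>t\<in>T. \<exists>s\<in>S. x = t + of_int N * s"
    by (rule finite_residues[OF assms])
  have mono: "I \<subseteq> J"
    if I: "ideal I (subring_on S)" "of_int N \<in> I" and J: "ideal J (subring_on S)" "of_int N \<in> J"
      and T_eq: "T \<inter> I = T \<inter> J" for I J
  proof
    fix x assume x: "x \<in> I"
    then obtain t s where ts: "t \<in> T" "s \<in> S" "x = t + of_int N * s"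
      using T(2) ideal_subring_onD(1)[OF I(1)] by blast
    have "x - s * of_int N \<in> I" by (intro ideal_subring_onD[OF I(1)] x ts I)
    then have "t \<in> J" using ts T_eq by (auto simp: mult.commute)
    then have "t + s * of_int N \<in> J" by (intro ideal_subring_onD[OF J(1)] ts J)
    then show "x \<in> J" by (simp add: ts mult.commute)
  qed
  have "inj_on (\<lambda>J. T \<inter> J) {J. ideal J (subring_on S) \<and> of_int N \<in> J}"
    using mono by (intro inj_onI equalityI) auto
  then show ?thesis
    by (rule inj_on_finite[of _ _ "Pow T"]) (use T(1) in auto)
qed

lemma exists_prime_denominator_ideal:
  assumes c: "c \<in> fraction_field S" "c \<notin> S"
  obtains r where "r \<in> S" "primeideal (denominator_ideal (r * c)) (subring_on S)"
proof -
  obtain N :: int where N: "N > 0" "of_int N * c \<in> S"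
    using c(1) by (rule fraction_field_int_denominator)
  define \<D> where "\<D> = (\<lambda>r. denominator_ideal (r * c)) ` {r \<in> S. r * c \<notin> S}"
  have "of_int N \<in> denominator_ideal (r * c)" if "r \<in> S" for r
    using mult_mem[OF that N(2)] by (simp add: denominator_ideal_def of_int_mem mult.left_commute)
  then have "\<D> \<subseteq> {J. ideal J (subring_on S) \<and> of_int N \<in> J}"
    using ideal_denominator_ideal unfolding \<D>_def by blast
  then have "finite \<D>" using finite_ideals_containing_int[OF N(1)] by (rule finite_subset)
  moreover have "denominator_ideal (1 * c) \<in> \<D>"
    unfolding \<D>_def using c(2) one_mem by (intro imageI) simp
  ultimately obtain P where P: "P \<in> \<D>" "\<And>Q. Q \<in> \<D> \<Longrightarrow> P \<subseteq> Q \<Longrightarrow> P = Q"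
    using finite_has_maximal[of \<D>] by blast
  then obtain r where r: "r \<in> S" "r * c \<notin> S" "P = denominator_ideal (r * c)"
    by (auto simp: \<D>_def)
  have "primeideal (denominator_ideal (r * c)) (subring_on S)"
  proof (rule primeideal_maximal_denominator_ideal[OF r(2)])
    fix x assume x: "x \<in> S" "x * (r * c) \<notin> S"
    then have "denominator_ideal (x * (r * c)) \<in> \<D>"
      unfolding \<D>_def using r(1)
      by (intro image_eqI[of _ _ "x * r"]) (simp_all add: mult_mem mult.assoc)
    moreover have "P \<subseteq> denominator_ideal (x * (r * c))"
      unfolding r(3) using x(1) by (rule denominator_ideal_subset_mult)
    ultimately show "denominator_ideal (x * (r * c)) \<subseteq> denominator_ideal (r * c)"
      using P(2) r(3) by blast
  qed
  with r(1) that show ?thesis by blast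
qed

text \<open>By the pigeonhole principle two powers of \<open>s\<close> agree modulo \<open>P\<close>.\<close>

lemma nonzero_primeideal_inverse_mod:
  assumes P: "primeideal P (subring_on S)" and x: "x \<in> P" "x \<noteq> 0" and s: "s \<in> S" "s \<notin> P"
  obtains u where "u \<in> S" "1 - u * s \<in> P"
proof -
  note P = primeideal_subring_onD[OF P]
  note PD = ideal_subring_onD[OF P(1)]
  obtain N :: int where N: "N > 0" "of_int N \<in> P"
    by (rule ideal_contains_positive_int[OF P(1) x])
  obtain T where T: "finite T" "\<forall>x\<in>S. \<exists>t\<in>T. \<exists>q\<in>S. x = t + of_int N * q"
    by (rule finite_residues[OF N(1)])
  have "\<forall>n. \<exists>t\<in>T. \<exists>q\<in>S. s ^ n = t + of_int N * q" using T(2) power_mem[OF s(1)] by blast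
  then obtain t q where t: "\<And>n. t n \<in> T" "\<And>n. q n \<in> S" "\<And>n. s ^ n = t n + of_int N * q n"
    by metis
  have "finite (range t)" using t(1) by (intro finite_subset[OF _ T(1)]) auto
  then have "\<not> inj t" using range_inj_infinite by blast
  then obtain i j where ij: "i < j" "t i = t j" unfolding inj_def by (metis linorder_neqE_nat)
  have "s ^ n \<notin> P" for n
    by (induction n) (use P s power_mem in auto)
  moreover have "s ^ i * (1 - s ^ (j - i)) \<in> P"
  proof -
    have "s ^ i * (1 - s ^ (j - i)) = s ^ i - s ^ j"
      using ij by (simp add: right_diff_distrib flip: power_add)
    also have "\<dots> = (q i - q j) * of_int N"
      using t(3)[of i] t(3)[of j] ij by (simp add: algebra_simps)
    also have "\<dots> \<in> P" by (intro PD(4) diff_mem t N)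
    finally show ?thesis .
  qed
  ultimately have "1 - s ^ (j - i) \<in> P"
    using P(3)[of "s ^ i" "1 - s ^ (j - i)"] s by (auto intro: mem_intros)
  moreover have "s ^ (j - i) = s ^ (j - i - 1) * s" using ij power_minus_mult[of "j - i" s] by simp
  ultimately show ?thesis using that power_mem[OF s(1)] by metis
qed

lemma prime_denominator_ideal_invertible:
  assumes c: "c \<in> fraction_field S" and P: "primeideal (denominator_ideal c) (subring_on S)"
  obtains r where "r \<in> denominator_ideal c" "1 - c * r \<in> denominator_ideal c"
proof -
  note PD = primeideal_subring_onD[OF P]
  have "c \<notin> S" using PD(2) one_mem by (simp add: denominator_ideal_def)
  obtain N :: int where N: "N > 0" "of_int N * c \<in> S"
    using c by (rule fraction_field_int_denominator)
  then have N_mem: "of_int N \<in> denominator_ideal c" "of_int N \<noteq> (0 :: 'a)"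
    by (auto simp: denominator_ideal_def of_int_mem)
  obtain x where x: "x \<in> denominator_ideal c" "c * x \<notin> denominator_ideal c"
    using stabilizes_ideal_imp_mem[OF PD(1) N_mem c] \<open>c \<notin> S\<close> by blast
  have "c * x \<in> S" using x(1) by (simp add: denominator_ideal_def mult.commute)
  then obtain u where u: "u \<in> S" "1 - u * (c * x) \<in> denominator_ideal c"
    using nonzero_primeideal_inverse_mod[OF P N_mem _ x(2)] by blast
  show ?thesis
  proof
    show "u * x \<in> denominator_ideal c" using u(1) x(1) by (rule ideal_subring_onD[OF PD(1)])
    show "1 - c * (u * x) \<in> denominator_ideal c" using u(2) by (simp add: mult_ac)
  qed
qed

lemma prime_square_dvd_PIdl:
  assumes a: "a \<noteq> 0" and c: "c \<in> fraction_field S"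
    and P: "primeideal P (subring_on S)" "P = denominator_ideal c" and aP: "a \<in> P" "c * a \<in> P"
  shows "ideal_dvd (subring_on S) (P \<cdot>\<^bsub>subring_on S\<^esub> P) (PIdl\<^bsub>subring_on S\<^esub> a)"
proof (rule ideal_dvd_PIdlI[OF _ a])
  let ?PP = "P \<cdot>\<^bsub>subring_on S\<^esub> P" and ?L = "colon_ideal a (P \<cdot>\<^bsub>subring_on S\<^esub> P)"
  note P_ideal = primeideal_subring_onD(1)[OF P(1)]
  show PP: "ideal ?PP (subring_on S)" by (rule ideal_prod_subring_on[OF P_ideal P_ideal])
  have PD: "x \<in> S" "c * x \<in> S" if "x \<in> P" for x
    using that by (simp_all add: P(2) denominator_ideal_def mult.commute)
  have "?PP \<subseteq> {w. w \<in> S \<and> c * w \<in> S \<and> c\<^sup>2 * w \<in> S}"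
  proof (rule ideal_prod_subset)
    fix x y assume xy: "x \<in> P" "y \<in> P"
    have "x * y \<in> S" "(c * x) * y \<in> S" "(c * x) * (c * y) \<in> S"
      using PD[OF xy(1)] PD[OF xy(2)] by (simp_all only: mult_mem)
    then show "x * y \<in> {w. w \<in> S \<and> c * w \<in> S \<and> c\<^sup>2 * w \<in> S}"
      by (simp add: power2_eq_square mult_ac)
  qed (simp add: distrib_left add_mem)
  then have "w \<in> S" "w * c \<in> S" "w * c\<^sup>2 \<in> S" if "w \<in> ?PP" for w
    using that by (auto simp: mult.commute)
  moreover have "a \<in> S" "c * a \<in> S" "c * (c * a) \<in> S" using PD[OF aP(1)] PD[OF aP(2)] by blast+
  ultimately have L: "a \<in> ?L" "c * a \<in> ?L" "c\<^sup>2 * a \<in> ?L"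
    using a by (simp_all add: colon_ideal_def power2_eq_square mult.assoc)
  note L_double = ideal_subring_onD(3)[OF ideal_colon_ideal L(2,2)]
  obtain r where r: "r \<in> P" "1 - c * r \<in> P"
    using prime_denominator_ideal_invertible[OF c] P by blast
  define x where "x = 1 - c * r"
  have x: "x \<in> P" using r(2) by (simp add: x_def)
  have "a = (c * r + x)\<^sup>2 * a" by (simp add: x_def)
  also have "\<dots> = r * r * (c\<^sup>2 * a) + r * x * (c * a + c * a) + x * x * a"
    by (simp add: power2_eq_square algebra_simps)
  also have "\<dots> \<in> ?PP \<cdot>\<^bsub>subring_on S\<^esub> ?L"
    by (intro ideal_subring_onD(3)[OF ideal_prod_subring_on[OF PP ideal_colon_ideal]]
      ideal_prod_mem r(1) x L L_double)
  finally show "a \<in> ?PP \<cdot>\<^bsub>subring_on S\<^esub> ?L" .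
qed

theorem squarefree_ideal_iff_radical:
  assumes a: "a \<in> S" "a \<noteq> 0"
  shows "squarefree_ideal (subring_on S) (PIdl\<^bsub>subring_on S\<^esub> a) \<longleftrightarrow>
    (\<forall>x\<in>S. x\<^sup>2 / a \<in> S \<longrightarrow> x / a \<in> S)"
proof (intro iffI ballI impI)
  fix x assume squarefree: "squarefree_ideal (subring_on S) (PIdl\<^bsub>subring_on S\<^esub> a)"
    and x: "x \<in> S" "x\<^sup>2 / a \<in> S"
  show "x / a \<in> S"
  proof (rule ccontr)
    assume "x / a \<notin> S"
    then obtain r where r: "r \<in> S" "primeideal (denominator_ideal (r * (x / a))) (subring_on S)"
      using exists_prime_denominator_ideal divide_mem_fraction_field[OF x(1) a(1)] by blast
    define c where "c = r * (x / a)"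
    have "c * a = r * x" "c * (c * a) = r\<^sup>2 * (x\<^sup>2 / a)"
      using a(2) by (simp_all add: c_def power2_eq_square)
    then have "c * a \<in> S" "c * (c * a) \<in> S" using r(1) x by (simp_all only: mult_mem power_mem)
    then have "a \<in> denominator_ideal c" "c * a \<in> denominator_ideal c"
      using a(1) by (simp_all add: denominator_ideal_def mult.commute)
    moreover have "c \<in> fraction_field S"
      using divide_mem_fraction_field[OF mult_mem[OF r(1) x(1)] a(1)] by (simp add: c_def)
    ultimately show False
      using prime_square_dvd_PIdl[OF a(2)] r(2) squarefree
      unfolding squarefree_ideal_def c_def by blast
  qed
qed (use squarefree_ideal_if_radical[OF a(2)] in blast)

lemma squarefree_dvd_power_imp_dvd:
  assumes a: "a \<in> S" "a \<noteq> 0" and squarefree: "squarefree_ideal (subring_on S) (PIdl\<^bsub>subring_on S\<^esub> a)"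
    and x: "x \<in> S" "n > 0" "x ^ n / a \<in> S"
  shows "x / a \<in> S"
  using x(2,3)
proof (induction n rule: less_induct)
  case (less n)
  show ?case
  proof (cases "n = 1")
    case True
    with less.prems show ?thesis by simp
  next
    case False
    define m where "m = (n + 1) div 2"
    have m: "0 < m" "m < n" "2 * m = n \<or> 2 * m = n + 1" using less.prems False by (auto simp: m_def)
    then have "(x ^ m)\<^sup>2 = x ^ n \<or> (x ^ m)\<^sup>2 = x * x ^ n"
      by (metis mult.commute power_mult power_Suc Suc_eq_plus1)
    then have "(x ^ m)\<^sup>2 / a \<in> S" using less.prems x(1) mult_mem by (metis times_divide_eq_right)
    then have "x ^ m / a \<in> S"
      using squarefree squarefree_ideal_iff_radical[OF a] power_mem[OF x(1)] by blast
    then show ?thesis using less.IH m by blast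
  qed
qed

lemma squarefree_power_times_power_mem:
  assumes a: "a \<in> S" "a \<noteq> 0" and squarefree: "squarefree_ideal (subring_on S) (PIdl\<^bsub>subring_on S\<^esub> a)"
    and c: "c \<in> fraction_field S" "c ^ n * a ^ k \<in> S" and k: "k < n"
  shows "c \<in> S"
proof -
  interpret K: subfield_set "fraction_field S" by (rule subfield_set_fraction_field)
  have "a ^ n = a ^ k * a ^ (n - Suc k) * a"
    using k by (simp only: power_add[symmetric] power_Suc2[symmetric]) simp
  then have eq: "(c * a) ^ n = c ^ n * a ^ k * a ^ (n - Suc k) * a"
    by (simp add: power_mult_distrib mult_ac)
  then have "(c * a) ^ n / a = c ^ n * a ^ k * a ^ (n - Suc k)" using a(2) by simp
  also have "\<dots> \<in> S" using a(1) c(2) by (intro mult_mem[of "c ^ n * a ^ k"] power_mem)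
  finally have "(c * a) ^ n / a \<in> S" .
  moreover have "c * a \<in> S"
  proof (rule integrally_closed)
    show "c * a \<in> fraction_field S"
      using c(1) a(1) subset_fraction_field by (blast intro: K.mult_mem)
    have "(c * a) ^ n \<in> S" unfolding eq using a(1) c(2)
      by (intro mult_mem[of "_ * _" a] mult_mem[of "c ^ n * a ^ k"] power_mem)
    then have "algebraic_int ((c * a) ^ n)" by (rule algebraic_int)
    then show "algebraic_int (c * a)" by (rule algebraic_int_if_power) (use k in simp)
  qed
  ultimately have "c * a / a \<in> S"
    using squarefree_dvd_power_imp_dvd[OF a squarefree, of "c * a" n] k by simp
  with a(2) show ?thesis by simp
qed

end

section \<open>Roots of unity\<close>

lemma (in subring_of_field) one_minus_power_divide_mem:
  assumes "x \<in> S" shows "(1 - x ^ k) / (1 - x) \<in> S"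
proof (cases "x = 1")
  case False
  then have "(1 - x ^ k) / (1 - x) = (\<Sum>i<k. x ^ i)" by (simp add: one_diff_power_eq)
  then show ?thesis using assms by (simp add: sum_mem power_mem)
qed (simp add: zero_mem)

locale primitive_root =
  fixes n :: nat and \<zeta> :: "'a::field"
  assumes primitive: "primitive_root_of_unity n \<zeta>"
begin

lemma n_pos: "n > 0"
  using primitive by (simp add: primitive_root_of_unity_def)

lemma root_power_n [simp]: "\<zeta> ^ n = 1"
  using primitive by (simp add: primitive_root_of_unity_def)

lemma root_nonzero: "\<zeta> \<noteq> 0"
  by (metis root_power_n n_pos zero_power zero_neq_one)

lemma root_power_mod: "\<zeta> ^ (k mod n) = \<zeta> ^ k"
proof -
  have "\<zeta> ^ k = \<zeta> ^ (n * (k div n) + k mod n)" by simp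
  also have "\<dots> = \<zeta> ^ (k mod n)" unfolding power_add power_mult by simp
  finally show ?thesis by simp
qed

lemma root_power_eq_1_iff: "\<zeta> ^ k = 1 \<longleftrightarrow> n dvd k"
proof
  assume "\<zeta> ^ k = 1"
  moreover have "k mod n < n" using n_pos by simp
  ultimately have "k mod n = 0"
    using primitive root_power_mod[of k] unfolding primitive_root_of_unity_def by (metis gr0I)
  then show "n dvd k" by auto
next
  assume "n dvd k"
  then show "\<zeta> ^ k = 1" using root_power_mod[of k] by simp
qed

lemma root_power_power_n [simp]: "(\<zeta> ^ k) ^ n = 1"
  by (simp add: root_power_eq_1_iff flip: power_mult)

lemma inj_on_root_power: "inj_on (\<lambda>j. \<zeta> ^ j) {..<n}"
proof (rule linorder_inj_onI')
  fix i j assume ij: "i \<in> {..<n}" "j \<in> {..<n}" "i < j"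
  then have "\<zeta> ^ j = \<zeta> ^ i * \<zeta> ^ (j - i)" by (simp flip: power_add)
  moreover have "\<not> n dvd (j - i)" using ij by (auto dest: dvd_imp_le)
  ultimately show "\<zeta> ^ i \<noteq> \<zeta> ^ j" using root_power_eq_1_iff[of "j - i"] root_nonzero by auto
qed

lemma prod_linear_root_powers: "(\<Prod>j<n. [:- (\<zeta> ^ j), 1:]) = monom 1 n - 1"
proof (rule poly_eqI_degree_lead_coeff[where A = "(\<lambda>j. \<zeta> ^ j) ` {..<n}" and n = n])
  let ?P = "\<Prod>j<n. [:- (\<zeta> ^ j), 1:]"
  have deg: "degree ?P = n" by (simp add: degree_prod_sum_eq)
  then show "degree ?P \<le> n" by simp
  have "lead_coeff ?P = 1" by (simp add: lead_coeff_prod)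
  then show "coeff ?P n = coeff (monom 1 n - 1) n" using deg n_pos by (simp add: coeff_1)
  show "degree (monom 1 n - 1 :: 'a poly) \<le> n"
    by (intro degree_diff_le) (simp_all add: degree_monom_le)
  show "n \<le> card ((\<lambda>j. \<zeta> ^ j) ` {..<n})" by (simp add: card_image inj_on_root_power)
  show "poly ?P z = poly (monom 1 n - 1) z" if "z \<in> (\<lambda>j. \<zeta> ^ j) ` {..<n}" for z
    using that by (auto simp: poly_prod poly_monom)
qed

lemma prod_diff_root_power_times: "(\<Prod>j<n. x - \<zeta> ^ j * b) = x ^ n - b ^ n"
proof (cases "b = 0")
  case True
  then show ?thesis using n_pos by (simp add: power_0_left)
next
  case False
  have "(\<Prod>j<n. x - \<zeta> ^ j * b) = (\<Prod>j<n. b * (x / b - \<zeta> ^ j))"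
    using False by (intro prod.cong) (auto simp: field_simps)
  also have "\<dots> = b ^ n * poly (\<Prod>j<n. [:- (\<zeta> ^ j), 1:]) (x / b)"
    by (simp add: prod.distrib poly_prod)
  also have "\<dots> = x ^ n - b ^ n"
    unfolding prod_linear_root_powers using False by (simp add: poly_monom field_simps)
  finally show ?thesis .
qed

lemma prod_one_minus_root_powers: "(\<Prod>j\<in>{1..<n}. 1 - \<zeta> ^ j) = of_nat n"
proof -
  define Q where "Q = (\<Prod>j\<in>{1..<n}. [:- (\<zeta> ^ j), 1:])"
  have "[:- 1, 1:] * Q = (\<Prod>j<n. [:- (\<zeta> ^ j), 1:])"
    using n_pos by (simp add: Q_def prod.atLeast_Suc_lessThan atLeast0LessThan[symmetric])
  also have "\<dots> = [:0, 1:] ^ n - 1" by (simp add: prod_linear_root_powers monom_altdef)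
  also have "\<dots> = [:- 1, 1:] * (\<Sum>i<n. [:0, 1:] ^ i)"
    unfolding power_diff_1_eq by (simp add: one_pCons)
  finally have "Q = (\<Sum>i<n. [:0, 1:] ^ i)" by (simp del: mult_pCons_left)
  then have "poly Q 1 = of_nat n" by (simp add: poly_sum)
  then show ?thesis by (simp add: Q_def poly_prod)
qed

lemma sum_root_powers: "(\<Sum>j<n. \<zeta> ^ (j * k)) = (if n dvd k then of_nat n else 0)"
proof (cases "n dvd k")
  case True
  then have "\<zeta> ^ (j * k) = 1" for j by (simp add: root_power_eq_1_iff)
  with True show ?thesis by simp
next
  case False
  then have "\<zeta> ^ k \<noteq> 1" by (simp add: root_power_eq_1_iff)
  have "(\<Sum>j<n. \<zeta> ^ (j * k)) = (\<Sum>j<n. (\<zeta> ^ k) ^ j)"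
    by (simp add: mult.commute flip: power_mult)
  also have "\<dots> = ((\<zeta> ^ k) ^ n - 1) / (\<zeta> ^ k - 1)" by (rule geometric_sum) fact
  finally show ?thesis using False by simp
qed

lemma coeff_from_conjugates:
  assumes g: "degree g < n" and k: "k < n"
  shows "(\<Sum>j<n. \<zeta> ^ (j * (n - k)) * poly g (\<zeta> ^ j * b)) = of_nat n * coeff g k * b ^ k"
proof -
  have dvd_iff: "n dvd (n - k + i) \<longleftrightarrow> i = k" if i: "i < n" for i
  proof
    assume "n dvd n - k + i"
    then obtain q where q: "n - k + i = n * q" by auto
    have "q > 0" using q k by (intro gr0I) auto
    moreover have "n - k + i < n * 2" using i k by auto
    then have "q < 2" unfolding q by (simp only: mult_less_cancel1)
    ultimately have "q = 1" by simp
    with q k show "i = k" by auto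
  qed (use k in auto)
  have "(\<Sum>j<n. \<zeta> ^ (j * (n - k)) * poly g (\<zeta> ^ j * b)) =
    (\<Sum>j<n. \<Sum>i<n. coeff g i * b ^ i * \<zeta> ^ (j * (n - k + i)))"
    by (simp add: poly_eq_sum_lessThan[OF g] sum_distrib_left power_mult_distrib power_add
      distrib_left mult_ac flip: power_mult)
  also have "\<dots> = (\<Sum>i<n. coeff g i * b ^ i * (\<Sum>j<n. \<zeta> ^ (j * (n - k + i))))"
    by (subst sum.swap) (simp add: sum_distrib_left)
  also have "\<dots> = (\<Sum>i<n. if i = k then of_nat n * coeff g k * b ^ k else 0)"
    by (intro sum.cong) (auto simp: sum_root_powers dvd_iff)
  also have "\<dots> = of_nat n * coeff g k * b ^ k" using k by simp
  finally show ?thesis .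
qed

lemma one_minus_root_divide_mem:
  assumes S: "subring_of_field S" "\<zeta> \<in> S" and j: "coprime j n"
  shows "(1 - \<zeta>) / (1 - \<zeta> ^ j) \<in> S"
proof -
  interpret subring_of_field S by (rule S)
  obtain k where "[j * k = Suc 0] (mod n)" using cong_solve_coprime_nat[OF j] by blast
  then have "\<zeta> ^ (j * k) = \<zeta>"
    using root_power_mod[of "j * k"] root_power_mod[of 1] by (simp add: cong_def)
  then show ?thesis
    using one_minus_power_divide_mem[OF power_mem[OF S(2)], of j k] by (simp flip: power_mult)
qed

end

section \<open>Cyclotomic integers of prime conductor\<close>

lemma prime_dvd_power_minus_self:
  fixes m :: int
  assumes p: "prime p" shows "int p dvd m ^ p - m"
proof -
  have "p > 0" using p by (rule prime_gt_0_nat)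
  define a where "a = nat (m mod int p)"
  have m: "[m = int a] (mod int p)" using \<open>p > 0\<close> by (simp add: a_def cong_def)
  have "[a ^ p = a] (mod p)"
  proof (cases "p dvd a")
    case True
    then have "p dvd a ^ p" using \<open>p > 0\<close> by (simp add: dvd_power dvd_trans)
    with True show ?thesis by (simp add: cong_def)
  next
    case False
    then have "[a ^ (p - 1) * a = 1 * a] (mod p)" by (intro cong_mult fermat_theorem p cong_refl)
    then show ?thesis using power_minus_mult[OF \<open>p > 0\<close>, of a] by simp
  qed
  then have "[int a ^ p = int a] (mod int p)" by (simp flip: cong_int_iff)
  then have "[m ^ p = m] (mod int p)" using m by (meson cong_pow cong_sym cong_trans)
  then show ?thesis by (simp add: cong_iff_dvd_diff)
qed

locale prime_cyclotomic = primitive_root p \<zeta> for p :: nat and \<zeta> :: complex +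
  assumes prime_p: "prime p"
begin

abbreviation R :: "complex set" where "R \<equiv> cyclotomic_ring \<zeta>"

abbreviation K :: "complex set" where "K \<equiv> fraction_field R"

definition \<pi> :: complex where "\<pi> = 1 - \<zeta>"

lemma p_gt_1: "p > 1"
  using prime_p by (rule prime_gt_1_nat)

lemma of_nat_p_nonzero: "(of_nat p :: complex) \<noteq> 0"
  using n_pos by simp

lemma zeta_algebraic_int: "algebraic_int \<zeta>"
  by (rule algebraic_int_if_power[of _ p]) (simp_all add: n_pos)

sublocale R: integral_subring R
  by (rule Ints.integral_subring_ring_adjoin) (rule zeta_algebraic_int)

sublocale K: subfield_set K
  by (rule R.subfield_set_fraction_field)

lemma R_subset_K: "R \<subseteq> K"
  by (rule R.subset_fraction_field)

lemma zeta_mem: "\<zeta> \<in> R"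
  by (rule Ints.gen_mem_ring_adjoin)

lemma pi_mem: "\<pi> \<in> R"
  unfolding \<pi>_def by (intro R.mem_intros zeta_mem)

lemma pi_nonzero: "\<pi> \<noteq> 0"
  using root_power_eq_1_iff[of 1] p_gt_1 by (simp add: \<pi>_def)

lemma
  shows p_divide_pi_power_mem: "of_nat p / \<pi> ^ (p - 1) \<in> R"
    and pi_power_divide_p_mem: "\<pi> ^ (p - 1) / of_nat p \<in> R"
proof -
  have p: "of_nat p = (\<Prod>j\<in>{1..<p}. 1 - \<zeta> ^ j)" by (rule prod_one_minus_root_powers[symmetric])
  have pi_power: "\<pi> ^ (p - 1) = (\<Prod>j\<in>{1..<p}. 1 - \<zeta>)" by (simp add: \<pi>_def)
  have "(\<Prod>j\<in>{1..<p}. (1 - \<zeta> ^ j) / (1 - \<zeta>)) \<in> R"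
    by (intro R.prod_mem R.one_minus_power_divide_mem zeta_mem)
  then show "of_nat p / \<pi> ^ (p - 1) \<in> R" unfolding p pi_power by (simp only: prod_dividef)
  have "(\<Prod>j\<in>{1..<p}. (1 - \<zeta>) / (1 - \<zeta> ^ j)) \<in> R"
  proof (intro R.prod_mem one_minus_root_divide_mem R.subring_of_field_axioms zeta_mem)
    fix j assume "j \<in> {1..<p}"
    then have "\<not> p dvd j" by (intro nat_dvd_not_less) auto
    then show "coprime j p" using prime_imp_coprime[OF prime_p] by (simp add: coprime_commute)
  qed
  then show "\<pi> ^ (p - 1) / of_nat p \<in> R" unfolding p pi_power by (simp only: prod_dividef)
qed

lemma p_divide_small_pi_power_mem:
  assumes "k < p" shows "of_nat p / \<pi> ^ k \<in> R"
proof -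
  have "\<pi> ^ (p - 1) = \<pi> ^ (p - 1 - k) * \<pi> ^ k"
    using assms by (simp only: power_add[symmetric]) simp
  then have "of_nat p / \<pi> ^ k = of_nat p / \<pi> ^ (p - 1) * \<pi> ^ (p - 1 - k)"
    using pi_nonzero by simp
  also have "\<dots> \<in> R" by (intro R.mult_mem R.power_mem p_divide_pi_power_mem pi_mem)
  finally show ?thesis .
qed

lemma int_divide_p_if_divide_pi:
  assumes "c \<in> \<int>" "algebraic_int (c / \<pi>)"
  shows "c / of_nat p \<in> \<int>"
proof -
  obtain m where m: "c = of_int m" using assms(1) by (rule Ints_cases)
  have "algebraic_int ((c / \<pi>) ^ (p - 1) * (\<pi> ^ (p - 1) / of_nat p))"
    by (intro algebraic_int_intros assms(2) R.algebraic_int pi_power_divide_p_mem)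
  also have "(c / \<pi>) ^ (p - 1) * (\<pi> ^ (p - 1) / of_nat p) = of_int (m ^ (p - 1)) / of_int (int p)"
    using pi_nonzero by (simp add: m power_divide)
  finally have "of_int (m ^ (p - 1)) / of_int (int p) \<in> (\<int> :: complex set)"
    by (rule rational_algebraic_int_is_int) (intro Rats_divide Rats_of_int)
  then have "int p dvd m ^ (p - 1)" using n_pos by (simp only: of_int_div_of_int_in_Ints_iff) simp
  then have "int p dvd m" using prime_p by (auto intro: prime_dvd_power_int)
  then have "of_int m / of_int (int p) \<in> (\<int> :: complex set)" by (rule of_int_divide_in_Ints)
  then show ?thesis by (simp add: m)
qed

lemma one_divide_pi_notin_R: "1 / \<pi> \<notin> R"
proof
  assume "1 / \<pi> \<in> R"
  then have "1 / of_nat p \<in> (\<int> :: complex set)"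
    by (intro int_divide_p_if_divide_pi R.algebraic_int) auto
  then show False
    using of_int_div_of_int_in_Ints_iff[of 1 "int p", where 'a = complex] p_gt_1 by simp
qed

lemma pi_poly_divide_p_coeffs:
  assumes f: "f \<in> polys_over \<int>" "degree f < p - 1" and alg: "algebraic_int (poly f \<pi> / of_nat p)"
  shows "smult (1 / of_nat p) f \<in> polys_over \<int>"
proof -
  have f_int: "coeff f i \<in> \<int>" for i by (rule coeff_mem[OF f(1)])
  have "coeff f k / of_nat p \<in> \<int>" if k: "k < p - 1" for k
  proof -
    have "algebraic_int (coeff f k / of_nat p)"
    proof (rule algebraic_int.eisenstein_coeffs_dvd[where \<theta> = \<pi> and n = "p - 1" and a = "coeff f"
          and d = "of_nat p", unfolded mem_Collect_eq])
      show "algebraic_int ((\<Sum>i<p - 1. coeff f i * \<pi> ^ i) / of_nat p)"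
        using alg by (simp add: poly_eq_sum_lessThan[OF f(2)])
      fix i assume i: "i < p - 1" "algebraic_int (coeff f i * \<pi> ^ (p - 1 - 1) / of_nat p)"
      have "algebraic_int (coeff f i * \<pi> ^ (p - 1 - 1) / of_nat p * (of_nat p / \<pi> ^ (p - 1)))"
        by (intro algebraic_int_intros i(2) R.algebraic_int p_divide_pi_power_mem)
      also have "coeff f i * \<pi> ^ (p - 1 - 1) / of_nat p * (of_nat p / \<pi> ^ (p - 1)) = coeff f i / \<pi>"
        using i(1) pi_nonzero of_nat_p_nonzero power_minus_mult[of "p - 1" \<pi>]
        by (simp add: field_simps)
      finally have "coeff f i / of_nat p \<in> \<int>" by (rule int_divide_p_if_divide_pi[OF f_int])
      then show "algebraic_int (coeff f i / of_nat p)" by (rule int_imp_algebraic_int)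
    qed (use f_int k pi_mem pi_power_divide_p_mem in
        \<open>auto intro: R.algebraic_int int_imp_algebraic_int\<close>)
    moreover have "coeff f k / of_nat p \<in> \<rat>"
      using f_int[of k] Ints_subset_Rats by (intro Rats_divide) auto
    ultimately show ?thesis by (rule rational_algebraic_int_is_int)
  qed
  moreover have "coeff f k = 0" if "\<not> k < p - 1" for k using f(2) that by (intro coeff_eq_0) simp
  ultimately show ?thesis by (auto simp: polys_over_def) (metis Ints_0 div_0)
qed

lemma zeta_poly_divide_p_coeffs:
  assumes f: "f \<in> polys_over \<int>" "degree f < p - 1" and alg: "algebraic_int (poly f \<zeta> / of_nat p)"
  shows "smult (1 / of_nat p) f \<in> polys_over \<int>"
proof -
  define reflect where "reflect = (\<lambda>f :: complex poly. pcompose f [:1, - 1:])"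
  have mem: "reflect f \<in> polys_over \<int>" if "f \<in> polys_over \<int>" for f
    unfolding reflect_def using that by (intro Ints.pcompose_mem Ints.linear_mem) auto
  have "reflect (reflect f) = f" for f
    by (simp add: reflect_def pcompose_pCons flip: pcompose_assoc)
  moreover have "smult (1 / of_nat p) (reflect f) \<in> polys_over \<int>"
  proof (rule pi_poly_divide_p_coeffs[OF mem[OF f(1)]])
    show "degree (reflect f) < p - 1" using f(2) by (simp add: reflect_def)
    show "algebraic_int (poly (reflect f) \<pi> / of_nat p)"
      using alg by (simp add: reflect_def poly_pcompose \<pi>_def)
  qed
  ultimately show ?thesis using mem by (metis pcompose_smult reflect_def)
qed

lemma zeta_poly_eq_0_imp_0:
  assumes f: "f \<in> polys_over \<int>" "degree f < p - 1" and zero: "poly f \<zeta> = 0"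
  shows "f = 0"
proof -
  have mem: "smult (1 / of_nat p ^ k) f \<in> polys_over \<int>" for k
  proof (induction k)
    case (Suc k)
    then have "smult (1 / of_nat p) (smult (1 / of_nat p ^ k) f) \<in> polys_over \<int>"
      using f zero by (intro zeta_poly_divide_p_coeffs) auto
    then show ?case by (simp add: mult.commute)
  qed (use f in simp)
  show ?thesis
  proof (rule poly_eqI, rule ccontr)
    fix i assume nonzero: "coeff f i \<noteq> coeff 0 i"
    obtain c where c: "coeff f i = of_int c" using coeff_mem[OF f(1)] by (rule Ints_cases)
    have dvd: "int p ^ k dvd c" for k
    proof -
      have "of_int c / of_int (int p ^ k) \<in> (\<int> :: complex set)"
        using coeff_mem[OF mem[of k], of i] by (simp add: c)
      then show ?thesis using n_pos by (simp only: of_int_div_of_int_in_Ints_iff) simp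
    qed
    have "Suc (multiplicity (int p) c) \<le> multiplicity (int p) c"
      using nonzero c p_gt_1 by (intro multiplicity_geI dvd) auto
    then show False by simp
  qed
qed

definition \<Phi> :: "complex poly" where "\<Phi> = (\<Sum>i<p. monom 1 i)"

lemma coeff_Phi: "coeff \<Phi> i = (if i < p then 1 else 0)"
  by (simp add: \<Phi>_def coeff_sum sum.delta)

lemma degree_Phi: "degree \<Phi> = p - 1"
  using p_gt_1 by (intro antisym degree_le le_degree) (auto simp: coeff_Phi)

lemma Phi_Ints: "\<Phi> \<in> polys_over \<int>"
  by (simp add: polys_over_def coeff_Phi)

lemma Phi_monic: "lead_coeff \<Phi> = 1"
  using p_gt_1 by (simp add: degree_Phi coeff_Phi)

lemma poly_Phi_root_power: "\<not> p dvd j \<Longrightarrow> poly \<Phi> (\<zeta> ^ j) = 0"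
  using sum_root_powers[of j]
  by (simp add: \<Phi>_def poly_sum poly_monom mult.commute flip: power_mult)

lemma poly_Phi_zeta: "poly \<Phi> \<zeta> = 0"
  using poly_Phi_root_power[of 1] p_gt_1 by simp

lemma min_poly_Phi: "min_poly_over \<rat> \<zeta> \<Phi>"
  unfolding min_poly_over_def
proof (intro conjI ballI impI)
  show "\<Phi> \<in> polys_over \<rat>" using Phi_Ints polys_over_mono[OF Ints_subset_Rats] by blast
  fix f :: "complex poly" assume f: "f \<in> polys_over \<rat>" "poly f \<zeta> = 0" "degree f < degree \<Phi>"
  obtain d where d: "d \<noteq> 0" "smult d f \<in> polys_over \<int>"
    using Ints.clear_denominators f(1) unfolding fraction_field_Ints by blast
  then have "smult d f = 0" using f by (intro zeta_poly_eq_0_imp_0) (auto simp: degree_Phi)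
  with d show "f = 0" by simp
qed (use Phi_monic poly_Phi_zeta in auto)

lemma K_reduced:
  assumes "x \<in> K"
  obtains g where "g \<in> polys_over \<rat>" "degree g < p - 1" "x = poly g \<zeta>"
  using Ints.fraction_field_ring_adjoin_reduced[OF Phi_Ints Phi_monic poly_Phi_zeta
      zeta_algebraic_int assms]
  unfolding fraction_field_Ints degree_Phi by blast

text \<open>In the inversion formula the term \<open>j = 0\<close> is \<open>g(1)\<close>, which is not a conjugate of \<open>g(\<zeta>)\<close>; it is
  integral because the coefficient of \<open>\<zeta>\<^sup>p\<^sup>-\<^sup>1\<close> vanishes.\<close>

lemma p_times_coeffs_mem_Ints:
  assumes g: "g \<in> polys_over \<rat>" "degree g < p - 1" and alg: "algebraic_int (poly g \<zeta>)"
  shows "smult (of_nat p) g \<in> polys_over \<int>"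
proof -
  have deg: "degree g < p" using g(2) by simp
  have "algebraic_int (poly g (\<zeta> ^ j))" if "j \<in> {1..<p}" for j
  proof (rule algebraic_int_conjugate[OF _ min_poly_Phi _ g(1) alg])
    show "subring_of_field (\<rat> :: complex set)" by unfold_locales auto
    show "poly \<Phi> (\<zeta> ^ j) = 0" using that by (intro poly_Phi_root_power) (auto dest: dvd_imp_le)
  qed
  then have rest: "algebraic_int (\<Sum>j\<in>{1..<p}. \<zeta> ^ (j * k) * poly g (\<zeta> ^ j))" for k
    using zeta_algebraic_int by (intro algebraic_int_intros(6-8)) auto
  have coeff: "of_nat p * coeff g k =
      poly g 1 + (\<Sum>j\<in>{1..<p}. \<zeta> ^ (j * (p - k)) * poly g (\<zeta> ^ j))" if "k < p" for k
    using coeff_from_conjugates[OF deg that, of 1] n_pos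
    by (simp add: sum.atLeast_Suc_lessThan atLeast0LessThan[symmetric])
  have "coeff g (p - 1) = 0" using g(2) by (rule coeff_eq_0)
  then have "poly g 1 = - (\<Sum>j\<in>{1..<p}. \<zeta> ^ (j * (p - (p - 1))) * poly g (\<zeta> ^ j))"
    using coeff[of "p - 1"] n_pos by (simp add: eq_neg_iff_add_eq_0)
  then have g1: "algebraic_int (poly g 1)" by (simp only: algebraic_int_minus_iff rest)
  have "of_nat p * coeff g k \<in> \<int>" if "k < p" for k
  proof (rule rational_algebraic_int_is_int)
    show "algebraic_int (of_nat p * coeff g k)"
      unfolding coeff[OF that] by (intro algebraic_int_intros(4) g1 rest)
    show "of_nat p * coeff g k \<in> \<rat>" using coeff_mem[OF g(1)] by (intro Rats_mult) auto
  qed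
  moreover have "coeff g k = 0" if "\<not> k < p" for k using deg that by (intro coeff_eq_0) simp
  ultimately show ?thesis by (auto simp: polys_over_def) (metis Ints_0 mult_zero_right)
qed

lemma R_integrally_closed:
  assumes x: "x \<in> K" "algebraic_int x"
  shows "x \<in> R"
proof -
  obtain g where g: "g \<in> polys_over \<rat>" "degree g < p - 1" "x = poly g \<zeta>"
    using x(1) by (rule K_reduced)
  have "smult (1 / of_nat p) (smult (of_nat p) g) \<in> polys_over \<int>"
    using g x(2) of_nat_p_nonzero
    by (intro zeta_poly_divide_p_coeffs p_times_coeffs_mem_Ints) simp_all
  then have "g \<in> polys_over \<int>" using of_nat_p_nonzero by simp
  then show ?thesis using g(3) by (auto simp: ring_adjoin_def)
qed

lemma R_finitely_generated: "R = int_span ((^) \<zeta> ` {..<p - 1})"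
proof
  show "R \<subseteq> int_span ((^) \<zeta> ` {..<p - 1})"
  proof
    fix x assume "x \<in> R"
    moreover have "degree \<Phi> > 0" using p_gt_1 by (simp add: degree_Phi)
    ultimately obtain g where g: "g \<in> polys_over \<int>" "degree g < p - 1" "x = poly g \<zeta>"
      using Ints.ring_adjoin_reduced[OF Phi_Ints Phi_monic _ poly_Phi_zeta]
      unfolding degree_Phi by blast
    then show "x \<in> int_span ((^) \<zeta> ` {..<p - 1})" by (simp add: poly_mem_int_span_powers)
  qed
  show "int_span ((^) \<zeta> ` {..<p - 1}) \<subseteq> R"
  proof
    fix x assume "x \<in> int_span ((^) \<zeta> ` {..<p - 1})"
    then show "x \<in> R"
      by (induction rule: int_span_induct) (auto intro: R.mem_intros zeta_mem)
  qed
qed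

sublocale R: maximal_order R
  using R_finitely_generated R_integrally_closed by unfold_locales blast+

lemma residue_mod_pi:
  assumes "x \<in> R" obtains m :: int where "(x - of_int m) / \<pi> \<in> R"
proof -
  from assms obtain f where f: "f \<in> polys_over \<int>" "x = poly f \<zeta>" by (auto simp: ring_adjoin_def)
  obtain m where m: "poly f 1 = of_int m"
    using Ints.poly_mem[OF f(1) Ints_1] by (auto elim: Ints_cases)
  have "f - [:of_int m:] \<in> polys_over \<int>"
    by (intro subring_set.diff_mem[OF Ints.subring_set_polys_over] f Ints.const_mem) simp
  then obtain q where q: "q \<in> polys_over \<int>" "f - [:of_int m:] = q * [:- 1, 1:]"
    using m by (auto intro: Ints.linear_factor[of _ 1])
  then have "poly (f - [:of_int m:]) \<zeta> = poly (q * [:- 1, 1:]) \<zeta>" by simp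
  then have "(x - of_int m) / \<pi> = - poly q \<zeta>"
    using pi_nonzero by (simp add: f(2) \<pi>_def field_simps)
  moreover have "poly q \<zeta> \<in> R" unfolding ring_adjoin_def using q(1) by blast
  ultimately show ?thesis using that[of m] by (simp add: R.minus_mem)
qed

lemma int_divide_pi_mem_if_dvd:
  assumes "int p dvd m" shows "of_int m / \<pi> \<in> R"
proof -
  from assms obtain b where "m = int p * b" by (rule dvdE)
  then have "of_int m / \<pi> = of_nat p / \<pi> ^ 1 * of_int b" by simp
  also have "\<dots> \<in> R" using p_gt_1 by (intro R.mult_mem p_divide_small_pi_power_mem R.of_int_mem)
  finally show ?thesis .
qed

lemma int_dvd_if_divide_pi_mem:
  assumes "of_int m / \<pi> \<in> R" shows "int p dvd m"
proof -
  have "of_int m / of_nat p \<in> (\<int> :: complex set)"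
    using assms by (intro int_divide_p_if_divide_pi R.algebraic_int) auto
  then have "of_int m / of_int (int p) \<in> (\<int> :: complex set)" by simp
  then show ?thesis using n_pos by (simp only: of_int_div_of_int_in_Ints_iff) simp
qed

lemma pi_dvd_mult_iff:
  assumes x: "x \<in> R" and y: "y \<in> R"
  shows "x * y / \<pi> \<in> R \<longleftrightarrow> x / \<pi> \<in> R \<or> y / \<pi> \<in> R"
proof
  assume xy: "x * y / \<pi> \<in> R"
  obtain m where m: "(x - of_int m) / \<pi> \<in> R" using x by (rule residue_mod_pi)
  obtain n where n: "(y - of_int n) / \<pi> \<in> R" using y by (rule residue_mod_pi)
  have "of_int (m * n) / \<pi> = x * y / \<pi> - x * ((y - of_int n) / \<pi>) - (x - of_int m) / \<pi> * of_int n"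
    by (simp add: algebra_simps add_divide_distrib diff_divide_distrib)
  also have "\<dots> \<in> R" by (intro R.diff_mem R.mult_mem R.of_int_mem x xy m n)
  finally have "int p dvd m * n" by (rule int_dvd_if_divide_pi_mem)
  then have "of_int m / \<pi> \<in> R \<or> of_int n / \<pi> \<in> R"
    using prime_p int_divide_pi_mem_if_dvd by (metis prime_dvd_mult_iff prime_nat_int_transfer)
  moreover have "x / \<pi> \<in> R" if "of_int m / \<pi> \<in> R"
    using R.add_mem[OF m that] by (simp add: diff_divide_distrib)
  moreover have "y / \<pi> \<in> R" if "of_int n / \<pi> \<in> R"
    using R.add_mem[OF n that] by (simp add: diff_divide_distrib)
  ultimately show "x / \<pi> \<in> R \<or> y / \<pi> \<in> R" by blast
next
  assume "x / \<pi> \<in> R \<or> y / \<pi> \<in> R"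
  then show "x * y / \<pi> \<in> R"
    using R.mult_mem[of "x / \<pi>" y] R.mult_mem[of x "y / \<pi>"] x y by auto
qed

lemma pi_dvd_power_imp_dvd:
  assumes x: "x \<in> R" "x ^ n / \<pi> \<in> R" shows "x / \<pi> \<in> R"
  using x(2)
proof (induction n)
  case 0
  then show ?case using one_divide_pi_notin_R by simp
next
  case (Suc n)
  then show ?case using pi_dvd_mult_iff[OF x(1) R.power_mem[OF x(1)]] by auto
qed

lemma power_p_minus_self_divide_pi_mem:
  assumes x: "x \<in> R" shows "(x ^ p - x) / \<pi> \<in> R"
proof -
  obtain m where m: "(x - of_int m) / \<pi> \<in> R" using x by (rule residue_mod_pi)
  have "(x ^ p - of_int m ^ p) / \<pi> =
      (x - of_int m) / \<pi> * (\<Sum>i<p. of_int m ^ (p - Suc i) * x ^ i)"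
    by (simp add: power_diff_sumr2)
  also have "\<dots> \<in> R" by (intro R.mem_intros m x)
  finally have "(x ^ p - of_int m ^ p) / \<pi> \<in> R" .
  moreover have "of_int (m ^ p - m) / \<pi> \<in> R"
  proof (rule int_divide_pi_mem_if_dvd)
    show "int p dvd m ^ p - m" by (rule prime_dvd_power_minus_self[OF prime_p])
  qed
  ultimately have
    "(x ^ p - of_int m ^ p) / \<pi> + of_int (m ^ p - m) / \<pi> - (x - of_int m) / \<pi> \<in> R"
    by (intro R.diff_mem R.add_mem m)
  then show ?thesis by (simp add: add_divide_distrib diff_divide_distrib)
qed

lemma cong_mod_pi_squared_iff:
  fixes a b :: complex
  defines "\<pp> \<equiv> PIdl\<^bsub>subring_on R\<^esub> (1 - \<zeta>)"
  shows "cong_mod_ideal a b (\<pp> \<cdot>\<^bsub>subring_on R\<^esub> \<pp>) \<longleftrightarrow> (a - b) / \<pi>\<^sup>2 \<in> R"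
  unfolding cong_mod_ideal_def \<pp>_def \<pi>_def[symmetric] R.PIdl_prod[OF pi_mem pi_mem]
  using pi_nonzero by (simp add: R.mem_PIdl_iff power2_eq_square)

end

section \<open>Kummer extensions of prime degree\<close>

lemma (in subfield_set) mem_if_coprime_powers_mem:
  assumes "x ^ m \<in> S" "x ^ n \<in> S" "coprime m n" "m > 0"
  shows "x \<in> S"
proof (cases "x = 0")
  case False
  obtain a b where "m * a = n * b + 1" using bezout_nat[of m n] assms(3,4) by auto
  then have "(x ^ m) ^ a = (x ^ n) ^ b * x" by (simp flip: power_mult power_Suc2)
  then have "x = (x ^ m) ^ a / (x ^ n) ^ b" using False by simp
  also have "\<dots> \<in> S" by (intro divide_mem power_mem assms)
  finally show ?thesis .
qed (simp add: zero_mem)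

context prime_cyclotomic
begin

lemma power_degree_mem_if_dvd_kummer_poly:
  assumes F: "subfield_set F" "\<zeta> \<in> F" and g: "g \<in> polys_over F" "lead_coeff g = 1"
    and factor: "monom 1 p - [:b ^ p:] = q * g"
  shows "b ^ degree g \<in> F"
proof -
  interpret F: subfield_set F by (rule F)
  let ?d = "degree g"
  obtain root where "smult (lead_coeff g) (\<Prod>i<?d. [:- root i, 1:]) = g"
    by (rule complex_poly_decompose')
  then have g_prod: "g = (\<Prod>i<?d. [:- root i, 1:])" using g(2) by simp
  have "\<exists>j. root i = \<zeta> ^ j * b" if "i < ?d" for i
  proof -
    have "poly g (root i) = 0" using that by (subst g_prod) (auto simp: poly_prod)
    then have "poly (monom 1 p - [:b ^ p:]) (root i) = 0" unfolding factor by simp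
    then have "(\<Prod>j<p. root i - \<zeta> ^ j * b) = 0"
      unfolding prod_diff_root_power_times by (simp add: poly_monom)
    then show ?thesis by auto
  qed
  then obtain e where e: "\<And>i. i < ?d \<Longrightarrow> root i = \<zeta> ^ e i * b" by metis
  define u where "u = (\<Prod>i<?d. - (\<zeta> ^ e i))"
  have "coeff g 0 = poly g 0" by (rule poly_0_coeff_0[symmetric])
  also have "\<dots> = (\<Prod>i<?d. - (\<zeta> ^ e i) * b)" by (subst g_prod) (simp add: poly_prod e)
  also have "\<dots> = u * b ^ ?d" unfolding u_def prod.distrib by simp
  finally have "b ^ ?d = coeff g 0 / u" using root_nonzero by (simp add: u_def)
  moreover have "u \<in> F" unfolding u_def using F(2) by (intro F.mem_intros)
  ultimately show ?thesis using coeff_mem[OF g(1)] by (simp add: F.divide_mem)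
qed

lemma min_poly_kummer:
  assumes F: "subfield_set F" "\<zeta> \<in> F" and b: "b ^ p \<in> F" "b \<notin> F"
  shows "min_poly_over F b (monom 1 p - [:b ^ p:])" (is "min_poly_over F b ?M")
proof -
  interpret F: subfield_set F by (rule F)
  have M: "?M \<in> polys_over F" "poly ?M b = 0" "degree ?M = p" "lead_coeff ?M = 1"
    using F.monom_minus_const_mem[OF b(1)] monic_monom_minus_const[OF n_pos, of "b ^ p"]
    by (simp_all add: poly_monom)
  have "?M \<noteq> 0" using M(3) n_pos by (metis degree_0 less_irrefl)
  then obtain m where m: "min_poly_over F b m" using F.exists_min_poly M by blast
  obtain q where q: "?M = q * m" using F.min_poly_dvd[OF m M(1,2)] by blast
  note mD = min_poly_overD[OF m]
  have pos: "degree m > 0" using mD by (intro monic_root_imp_degree_pos)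
  have nonzero: "q \<noteq> 0" "m \<noteq> 0" using M(3) n_pos unfolding q by auto
  then have deg: "p = degree q + degree m" using M(3) unfolding q by (simp add: degree_mult_eq)
  have "b ^ degree m \<in> F" by (rule power_degree_mem_if_dvd_kummer_poly[OF F mD(1,2) q])
  then have "\<not> coprime p (degree m)" using F.mem_if_coprime_powers_mem[OF b(1)] b(2) n_pos by blast
  then have "p dvd degree m" using prime_imp_coprime[OF prime_p] by blast
  then have "degree q = 0" using deg pos by (auto dest: dvd_imp_le)
  then obtain c where c: "q = [:c:]" by (rule degree_eq_zeroE)
  have "c = 1" using M(4) mD(2) unfolding q lead_coeff_mult c by simp
  then show ?thesis using m unfolding q c by simp
qed

end

locale kummer = prime_cyclotomic +
  fixes \<alpha> \<beta> :: complex
  assumes odd_p: "odd p"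
    and alpha_mem: "\<alpha> \<in> R" and beta_power: "\<beta> ^ p = \<alpha>" and beta_notin: "\<beta> \<notin> R"
begin

abbreviation B :: "complex set" where "B \<equiv> ring_adjoin R \<beta>"

abbreviation E :: "complex set" where "E \<equiv> fraction_field B"

definition M :: "complex poly" where "M = monom 1 p - [:\<alpha>:]"

lemma p_ge_3: "p \<ge> 3"
  using p_gt_1 odd_p by (cases "p = 2") auto

lemma beta_algebraic_int: "algebraic_int \<beta>"
  by (rule algebraic_int_if_power[OF _ n_pos]) (simp add: beta_power R.algebraic_int alpha_mem)

sublocale B: integral_subring B
  by (rule R.integral_subring_ring_adjoin[OF beta_algebraic_int])

sublocale E: subfield_set E
  by (rule B.subfield_set_fraction_field)

lemma R_subset_B: "R \<subseteq> B"
  by (rule R.base_subset_ring_adjoin)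

lemma beta_mem: "\<beta> \<in> B"
  by (rule R.gen_mem_ring_adjoin)

lemma K_subset_E: "K \<subseteq> E"
  by (rule fraction_field_mono[OF R_subset_B])

lemma alpha_nonzero: "\<alpha> \<noteq> 0"
  using beta_power beta_notin R.zero_mem by auto

lemma min_poly_M: "min_poly_over K \<beta> M"
proof -
  have "\<beta> \<notin> K" using R_integrally_closed beta_algebraic_int beta_notin by blast
  then show ?thesis
    using min_poly_kummer[OF K.subfield_set_axioms, of \<beta>] zeta_mem alpha_mem R_subset_K
    by (auto simp: M_def beta_power)
qed

lemma degree_M: "degree M = p"
  unfolding M_def by (rule degree_monom_minus_const[OF n_pos])

lemma M_mem: "M \<in> polys_over R"
  unfolding M_def by (rule R.monom_minus_const_mem[OF alpha_mem])

lemma E_reduced: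
  assumes "x \<in> E"
  obtains g where "g \<in> polys_over K" "degree g < p" "x = poly g \<beta>"
  using R.fraction_field_ring_adjoin_reduced[OF M_mem _ _ beta_algebraic_int assms]
    min_poly_overD(2,3)[OF min_poly_M] unfolding degree_M by blast

lemma B_reduced:
  assumes "x \<in> B"
  obtains g where "g \<in> polys_over R" "degree g < p" "x = poly g \<beta>"
  using R.ring_adjoin_reduced[OF M_mem _ _ _ assms] min_poly_overD(2,3)[OF min_poly_M] n_pos
  unfolding degree_M by blast

lemma conjugate_algebraic_int:
  assumes "g \<in> polys_over K" "algebraic_int (poly g \<beta>)"
  shows "algebraic_int (poly g (\<zeta> ^ j * \<beta>))"
proof (rule algebraic_int_conjugate[OF K.subring_of_field_axioms min_poly_M _ assms])
  show "poly M (\<zeta> ^ j * \<beta>) = 0"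
    by (simp add: M_def poly_monom power_mult_distrib beta_power)
qed

lemma degree_smult_linear_power_less: "degree (smult c ([:- a, 1:] ^ (p - 1))) < p"
  using degree_smult_le[of c "[:- a, 1:] ^ (p - 1)"] n_pos by (simp add: degree_linear_power)

lemma smult_linear_power_mem:
  "c \<in> K \<Longrightarrow> a \<in> R \<Longrightarrow> smult c ([:- a, 1:] ^ n) \<in> polys_over K"
  using R_subset_K
  by (intro K.smult_mem subring_set.power_mem[OF K.subring_set_polys_over] K.linear_mem
    K.minus_mem K.one_mem) auto

lemma mem_R_if_times_linear_power_mem_B:
  assumes c: "c \<in> K" and a: "a \<in> R" and mem: "c * (\<beta> - a) ^ (p - 1) \<in> B"
  shows "c \<in> R"
proof -
  define g where "g = smult c ([:- a, 1:] ^ (p - 1))"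
  have "g \<in> polys_over R"
  proof (rule R.polys_over_if_poly_mem_ring_adjoin[OF min_poly_M M_mem])
    show "g \<in> polys_over K" unfolding g_def by (rule smult_linear_power_mem[OF c a])
    show "degree g < degree M" unfolding g_def degree_M by (rule degree_smult_linear_power_less)
    show "poly g \<beta> \<in> B" using mem by (simp add: g_def)
  qed
  then have "coeff g (p - 1) \<in> R" by (rule coeff_mem)
  then show ?thesis by (simp add: g_def coeff_linear_power)
qed

lemma integral_notin_B_if_not_squarefree:
  assumes "\<not> squarefree_ideal (subring_on R) (PIdl\<^bsub>subring_on R\<^esub> \<alpha>)"
  shows "\<exists>x\<in>E. algebraic_int x \<and> x \<notin> B"
proof -
  obtain j where j: "j \<in> R" "j\<^sup>2 / \<alpha> \<in> R" "j / \<alpha> \<notin> R"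
    using assms R.squarefree_ideal_iff_radical[OF alpha_mem alpha_nonzero] by blast
  have jK: "j / \<alpha> \<in> K" using j(1) alpha_mem by (rule R.divide_mem_fraction_field)
  define x where "x = j / \<alpha> * \<beta> ^ (p - 1)"
  have "algebraic_int x"
  proof (rule algebraic_int_if_power[OF _ n_pos])
    have "x ^ p = j ^ p / \<alpha> ^ p * \<alpha> ^ (p - 1)"
      by (simp add: x_def power_mult_distrib power_divide mult.commute flip: power_mult beta_power)
    also have "\<dots> = j ^ p / \<alpha>"
      using alpha_nonzero n_pos power_minus_mult[OF n_pos, of \<alpha>] by (simp add: field_simps)
    also have "j ^ p = j\<^sup>2 * j ^ (p - 2)"
      using p_ge_3 by (simp only: power_add[symmetric] le_add_diff_inverse)
    finally have "x ^ p = j\<^sup>2 / \<alpha> * j ^ (p - 2)" by simp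
    also have "\<dots> \<in> R" by (intro R.mult_mem R.power_mem j)
    finally show "algebraic_int (x ^ p)" by (rule R.algebraic_int)
  qed
  moreover have "x \<in> E"
    unfolding x_def using jK beta_mem K_subset_E B.subset_fraction_field
    by (intro E.mem_intros) auto
  moreover have "x \<notin> B"
    using mem_R_if_times_linear_power_mem_B[OF jK R.zero_mem] j(3) by (auto simp: x_def)
  ultimately show ?thesis by blast
qed

lemma shift_power_p:
  obtains w where "w \<in> B" "(\<beta> - \<alpha>) ^ p = \<alpha> - \<alpha> ^ p + of_nat p * w"
proof -
  have "- \<alpha> \<in> B" using alpha_mem R_subset_B by (intro B.minus_mem) auto
  then obtain w where "w \<in> B" "(\<beta> + - \<alpha>) ^ p = \<beta> ^ p + (- \<alpha>) ^ p + of_nat p * w"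
    by (rule B.freshmans_dream[OF prime_p beta_mem])
  then show ?thesis using that odd_p by (simp add: beta_power)
qed

lemma shift_power_p_divide_pi_power_mem:
  assumes "(\<alpha> ^ p - \<alpha>) / \<pi> ^ k \<in> R" "k < p"
  shows "(\<beta> - \<alpha>) ^ p / \<pi> ^ k \<in> B"
proof -
  obtain w where w: "w \<in> B" "(\<beta> - \<alpha>) ^ p = \<alpha> - \<alpha> ^ p + of_nat p * w" by (rule shift_power_p)
  then have "(\<beta> - \<alpha>) ^ p / \<pi> ^ k = of_nat p / \<pi> ^ k * w - (\<alpha> ^ p - \<alpha>) / \<pi> ^ k"
    by (simp add: add_divide_distrib diff_divide_distrib)
  also have "\<dots> \<in> B"
    using w(1) assms(1) p_divide_small_pi_power_mem[OF assms(2)] R_subset_B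
    by (intro B.diff_mem B.mult_mem) auto
  finally show ?thesis .
qed

lemma shift_mem: "\<beta> - \<alpha> \<in> B"
  using alpha_mem R_subset_B by (intro B.diff_mem beta_mem) auto

lemma integral_notin_B_if_congruent:
  assumes "(\<alpha> ^ p - \<alpha>) / \<pi>\<^sup>2 \<in> R"
  shows "\<exists>x\<in>E. algebraic_int x \<and> x \<notin> B"
proof -
  define x where "x = 1 / \<pi> * (\<beta> - \<alpha>) ^ (p - 1)"
  have piK: "1 / \<pi> \<in> K" by (intro R.divide_mem_fraction_field R.one_mem pi_mem)
  have "algebraic_int x"
  proof (rule algebraic_int_if_power[OF _ n_pos])
    have "2 * (p - 1) = p - 2 + p" using p_ge_3 by simp
    then have "\<pi> ^ (2 * (p - 1)) = \<pi> ^ (p - 2) * \<pi> ^ p" by (simp only: power_add)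
    then have "x ^ p = ((\<beta> - \<alpha>) ^ p / \<pi>\<^sup>2) ^ (p - 1) * \<pi> ^ (p - 2)"
      using pi_nonzero
      by (simp add: x_def power_mult_distrib power_divide mult.commute flip: power_mult)
    also have "\<dots> \<in> B"
      using assms p_ge_3 pi_mem R_subset_B
      by (intro B.mult_mem B.power_mem shift_power_p_divide_pi_power_mem) auto
    finally show "algebraic_int (x ^ p)" by (rule B.algebraic_int)
  qed
  moreover have "x \<in> E"
    unfolding x_def using piK shift_mem K_subset_E B.subset_fraction_field
    by (intro E.mult_mem E.power_mem) auto
  moreover have "x \<notin> B"
    using mem_R_if_times_linear_power_mem_B[OF piK alpha_mem] one_divide_pi_notin_R
    unfolding x_def by blast
  ultimately show ?thesis by blast
qed

lemma prod_conjugates_shift: "(\<Prod>j<p. \<zeta> ^ j * \<beta> - \<alpha>) = \<alpha> - \<alpha> ^ p"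
proof -
  have "(\<Prod>j<p. \<zeta> ^ j * \<beta> - \<alpha>) = (\<Prod>j<p. - 1 * (\<alpha> - \<zeta> ^ j * \<beta>))"
    by (intro prod.cong) auto
  also have "\<dots> = (- 1) ^ p * (\<alpha> ^ p - \<beta> ^ p)"
    unfolding prod.distrib prod_diff_root_power_times by simp
  also have "\<dots> = \<alpha> - \<alpha> ^ p" using odd_p by (simp add: beta_power)
  finally show ?thesis .
qed

text \<open>If \<open>c (\<beta> - \<alpha>)\<^sup>p\<^sup>-\<^sup>1 / \<pi>\<close> is integral, then so is its norm \<open>c\<^sup>p (\<alpha> - \<alpha>\<^sup>p)\<^sup>p\<^sup>-\<^sup>1 / \<pi>\<^sup>p\<close>, in which
  \<open>\<alpha> - \<alpha>\<^sup>p\<close> contributes exactly \<open>p - 1\<close> factors \<open>\<pi>\<close>.\<close>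

lemma pi_dvd_if_dvd_times_shift_power:
  assumes not_cong: "(\<alpha> ^ p - \<alpha>) / \<pi>\<^sup>2 \<notin> R"
    and c: "c \<in> R" "algebraic_int (c * (\<beta> - \<alpha>) ^ (p - 1) / \<pi>)"
  shows "c / \<pi> \<in> R"
proof -
  define m where "m = (\<alpha> ^ p - \<alpha>) / \<pi>"
  have m: "m \<in> R" "m / \<pi> \<notin> R"
    unfolding m_def using power_p_minus_self_divide_pi_mem[OF alpha_mem] not_cong
    by (simp_all add: power2_eq_square)
  define g where "g = smult (c / \<pi>) ([:- \<alpha>, 1:] ^ (p - 1))"
  have "g \<in> polys_over K"
    unfolding g_def by (intro smult_linear_power_mem R.divide_mem_fraction_field c pi_mem alpha_mem)
  then have "algebraic_int (\<Prod>j<p. poly g (\<zeta> ^ j * \<beta>))"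
    using c(2) by (intro algebraic_int_intros(9) conjugate_algebraic_int) (simp_all add: g_def)
  also have "(\<Prod>j<p. poly g (\<zeta> ^ j * \<beta>)) = (\<Prod>j<p. c / \<pi> * (\<zeta> ^ j * \<beta> - \<alpha>) ^ (p - 1))"
    by (simp add: g_def)
  also have "\<dots> = (c / \<pi>) ^ p * (\<Prod>j<p. \<zeta> ^ j * \<beta> - \<alpha>) ^ (p - 1)"
    by (simp only: prod.distrib prod_power_distrib prod_constant card_lessThan)
  also have "(\<Prod>j<p. \<zeta> ^ j * \<beta> - \<alpha>) = - (\<pi> * m)"
    unfolding prod_conjugates_shift m_def using pi_nonzero by simp
  also have "(c / \<pi>) ^ p * (- (\<pi> * m)) ^ (p - 1) = c ^ p * m ^ (p - 1) / \<pi>"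
    using pi_nonzero odd_p power_minus_mult[OF n_pos, of \<pi>]
    by (simp add: power_divide power_mult_distrib field_simps)
  finally have "algebraic_int (c ^ p * m ^ (p - 1) / \<pi>)" .
  moreover have "c ^ p * m ^ (p - 1) / \<pi> \<in> K"
    by (intro R.divide_mem_fraction_field R.mult_mem R.power_mem c m pi_mem)
  ultimately have "c ^ p * m ^ (p - 1) / \<pi> \<in> R" by (rule R_integrally_closed[rotated])
  then have "c ^ p / \<pi> \<in> R \<or> m ^ (p - 1) / \<pi> \<in> R"
    using pi_dvd_mult_iff R.power_mem c(1) m(1) by blast
  then show ?thesis using pi_dvd_power_imp_dvd c(1) m by blast
qed

lemma mem_B_if_pi_times_mem_B:
  assumes not_cong: "(\<alpha> ^ p - \<alpha>) / \<pi>\<^sup>2 \<notin> R"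
    and x: "algebraic_int x" "\<pi> * x \<in> B"
  shows "x \<in> B"
proof -
  obtain g where g: "g \<in> polys_over R" "degree g < p" "\<pi> * x = poly g \<beta>"
    using x(2) by (rule B_reduced)
  define h where "h = pcompose g [:\<alpha>, 1:]"
  have h: "coeff h i \<in> R" for i
    unfolding h_def by (intro coeff_mem R.pcompose_mem R.linear_mem g alpha_mem R.one_mem)
  have "degree h < p" using g(2) by (simp add: h_def)
  moreover have "\<pi> * x = poly h (\<beta> - \<alpha>)" by (simp add: h_def poly_pcompose g(3))
  ultimately have expansion: "\<pi> * x = (\<Sum>i<p. coeff h i * (\<beta> - \<alpha>) ^ i)"
    by (simp add: poly_eq_sum_lessThan)
  have "coeff h k / \<pi> \<in> R" if "k < p" for k
  proof (rule R_integrally_closed)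
    show "coeff h k / \<pi> \<in> K" by (intro R.divide_mem_fraction_field h pi_mem)
    show "algebraic_int (coeff h k / \<pi>)"
    proof (rule algebraic_int.eisenstein_coeffs_dvd[where \<theta> = "\<beta> - \<alpha>" and n = p and a = "coeff h"
          and d = \<pi>, unfolded mem_Collect_eq])
      show "algebraic_int ((\<beta> - \<alpha>) ^ p / \<pi>)"
        using shift_power_p_divide_pi_power_mem[of 1] p_gt_1
        by (simp add: power_p_minus_self_divide_pi_mem alpha_mem B.algebraic_int)
      show "algebraic_int ((\<Sum>i<p. coeff h i * (\<beta> - \<alpha>) ^ i) / \<pi>)"
        using x(1) pi_nonzero unfolding expansion[symmetric] by simp
      show "algebraic_int (coeff h i / \<pi>)"
        if "algebraic_int (coeff h i * (\<beta> - \<alpha>) ^ (p - 1) / \<pi>)" for i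
        by (rule R.algebraic_int[OF pi_dvd_if_dvd_times_shift_power[OF not_cong h that]])
    qed (use h that shift_mem in \<open>auto intro: R.algebraic_int B.algebraic_int\<close>)
  qed
  then have "(\<Sum>i<p. coeff h i / \<pi> * (\<beta> - \<alpha>) ^ i) \<in> B"
    using R_subset_B shift_mem by (intro B.sum_mem B.mult_mem B.power_mem) auto
  also have "(\<Sum>i<p. coeff h i / \<pi> * (\<beta> - \<alpha>) ^ i) = \<pi> * x / \<pi>"
    unfolding expansion sum_divide_distrib by simp
  also have "\<pi> * x / \<pi> = x" using pi_nonzero by simp
  finally show ?thesis .
qed

lemma p_times_integral_mem_B:
  assumes squarefree: "squarefree_ideal (subring_on R) (PIdl\<^bsub>subring_on R\<^esub> \<alpha>)"
    and x: "x \<in> E" "algebraic_int x"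
  shows "of_nat p * x \<in> B"
proof -
  obtain g where g: "g \<in> polys_over K" "degree g < p" "x = poly g \<beta>" using x(1) by (rule E_reduced)
  have "of_nat p * coeff g k \<in> R" (is "?c \<in> R") if k: "k < p" for k
  proof (rule R.squarefree_power_times_power_mem[OF alpha_mem alpha_nonzero squarefree _ _ k])
    show cK: "?c \<in> K" by (intro K.mult_mem K.of_nat_mem coeff_mem g)
    have "algebraic_int (\<Sum>j<p. \<zeta> ^ (j * (p - k)) * poly g (\<zeta> ^ j * \<beta>))"
      using g x(2) zeta_algebraic_int
      by (intro algebraic_int_intros(6-8) conjugate_algebraic_int) auto
    then have "algebraic_int ((?c * \<beta> ^ k) ^ p)"
      unfolding coeff_from_conjugates[OF g(2) k] by (rule algebraic_int_intros(7))
    also have "(?c * \<beta> ^ k) ^ p = ?c ^ p * \<alpha> ^ k"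
      by (simp add: power_mult_distrib mult.commute flip: beta_power power_mult)
    finally show "?c ^ p * \<alpha> ^ k \<in> R"
      using alpha_mem R_subset_K by (intro R_integrally_closed K.mult_mem K.power_mem cK) auto
  qed
  then have "(\<Sum>k<p. of_nat p * coeff g k * \<beta> ^ k) \<in> B"
    using R_subset_B by (intro B.sum_mem B.mult_mem[of _ "\<beta> ^ _"] B.power_mem beta_mem) auto
  then show ?thesis
    unfolding g(3) poly_eq_sum_lessThan[OF g(2)] by (simp add: sum_distrib_left mult.assoc)
qed

lemma integral_mem_B:
  assumes squarefree: "squarefree_ideal (subring_on R) (PIdl\<^bsub>subring_on R\<^esub> \<alpha>)"
    and not_cong: "(\<alpha> ^ p - \<alpha>) / \<pi>\<^sup>2 \<notin> R"
    and x: "x \<in> E" "algebraic_int x"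
  shows "x \<in> B"
proof -
  have descent: "\<pi> ^ k * x \<in> B \<Longrightarrow> x \<in> B" for k
  proof (induction k)
    case (Suc k)
    have "algebraic_int (\<pi> ^ k * x)"
      using x R.algebraic_int[OF pi_mem] by (intro algebraic_int_intros(6,7))
    then have "\<pi> ^ k * x \<in> B"
      by (rule mem_B_if_pi_times_mem_B[OF not_cong]) (use Suc.prems in \<open>simp add: mult.assoc\<close>)
    then show ?case by (rule Suc.IH)
  qed simp
  have "\<pi> ^ (p - 1) / of_nat p * (of_nat p * x) \<in> B"
    using pi_power_divide_p_mem R_subset_B
    by (intro B.mult_mem[of "\<pi> ^ (p - 1) / of_nat p"] p_times_integral_mem_B squarefree x) auto
  then show ?thesis using of_nat_p_nonzero by (intro descent[of "p - 1"]) simp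
qed

theorem ring_of_integers_eq_B_iff:
  "ring_of_integers E = B \<longleftrightarrow>
    squarefree_ideal (subring_on R) (PIdl\<^bsub>subring_on R\<^esub> \<alpha>) \<and> (\<alpha> ^ p - \<alpha>) / \<pi>\<^sup>2 \<notin> R"
proof -
  have "ring_of_integers E = B \<longleftrightarrow> (\<forall>x\<in>E. algebraic_int x \<longrightarrow> x \<in> B)"
    unfolding ring_of_integers_def using B.subset_fraction_field B.algebraic_int by blast
  then show ?thesis
    using integral_notin_B_if_not_squarefree integral_notin_B_if_congruent integral_mem_B by blast
qed

end

section \<open>Subfields generated by complex numbers\<close>

lemma ring_of_type_algebra_simps:
  fixes x y :: "'a::field"
  shows "\<zero>\<^bsub>ring_of_type_algebra\<^esub> = (0 :: 'a)" "\<one>\<^bsub>ring_of_type_algebra\<^esub> = (1 :: 'a)"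
    "\<ominus>\<^bsub>ring_of_type_algebra\<^esub> x = - x"
    "x \<oplus>\<^bsub>ring_of_type_algebra\<^esub> y = x + y" "x \<otimes>\<^bsub>ring_of_type_algebra\<^esub> y = x * y"
    "x \<noteq> 0 \<Longrightarrow> inv\<^bsub>ring_of_type_algebra\<^esub> x = inverse x"
proof -
  interpret A: Ring.field "ring_of_type_algebra :: 'a ring" by (rule field_from_type_algebra)
  note simps = ring_of_type_algebra_def
  show "\<zero>\<^bsub>ring_of_type_algebra\<^esub> = (0 :: 'a)" "\<one>\<^bsub>ring_of_type_algebra\<^esub> = (1 :: 'a)"
    "x \<oplus>\<^bsub>ring_of_type_algebra\<^esub> y = x + y"
    "x \<otimes>\<^bsub>ring_of_type_algebra\<^esub> y = x * y"
    by (simp_all add: simps)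
  show "\<ominus>\<^bsub>ring_of_type_algebra\<^esub> x = - x" by (rule A.minus_equality) (simp_all add: simps)
  show "inv\<^bsub>ring_of_type_algebra\<^esub> x = inverse x" if "x \<noteq> 0"
    using that by (intro A.comm_inv_char) (simp_all add: simps)
qed

lemma subfield_set_rat_adjoin: "subfield_set (rat_adjoin A)"
proof
  let ?C = "ring_of_type_algebra :: complex ring"
  note simps = ring_of_type_algebra_simps rat_adjoin_def
  show "1 \<in> rat_adjoin A" using generate_field.one[of ?C A] by (simp add: simps)
  have "- y \<in> rat_adjoin A" if "y \<in> rat_adjoin A" for y
    using generate_field.a_inv[of y ?C A] that by (simp add: simps)
  then show "x - y \<in> rat_adjoin A" if "x \<in> rat_adjoin A" "y \<in> rat_adjoin A" for x y
    using generate_field.eng_add[of x ?C A "- y"] that by (simp add: simps)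
  show "x * y \<in> rat_adjoin A" if "x \<in> rat_adjoin A" "y \<in> rat_adjoin A" for x y
    using generate_field.eng_mult[of x ?C A y] that by (simp add: simps)
  show "inverse x \<in> rat_adjoin A" if "x \<in> rat_adjoin A" for x
    using generate_field.m_inv[of x ?C A] that by (cases "x = 0") (simp_all add: simps)
qed

lemma subset_rat_adjoin: "A \<subseteq> rat_adjoin A"
  by (auto simp: rat_adjoin_def intro: generate_field.incl)

lemma rat_adjoin_subset:
  assumes "subfield_set F" "A \<subseteq> F" shows "rat_adjoin A \<subseteq> F"
proof
  interpret F: subfield_set F by fact
  fix x assume "x \<in> rat_adjoin A"
  then show "x \<in> F" unfolding rat_adjoin_def
    by (induction rule: generate_field.induct)
      (use assms(2) in \<open>auto simp: ring_of_type_algebra_simps intro: F.mem_intros F.inverse_mem\<close>)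
qed

lemma rat_adjoin_pair: "rat_adjoin {a, b} = fraction_field (ring_adjoin (ring_adjoin \<int> a) b)"
proof
  interpret A: subring_of_field "ring_adjoin \<int> a"
    by (rule subring_of_field.intro[OF Ints.subring_set_ring_adjoin])
  interpret AB: subring_of_field "ring_adjoin (ring_adjoin \<int> a) b"
    by (rule subring_of_field.intro[OF A.subring_set_ring_adjoin])
  have "a \<in> ring_adjoin (ring_adjoin \<int> a) b" "b \<in> ring_adjoin (ring_adjoin \<int> a) b"
    using Ints.gen_mem_ring_adjoin A.base_subset_ring_adjoin A.gen_mem_ring_adjoin by blast+
  then show "rat_adjoin {a, b} \<subseteq> fraction_field (ring_adjoin (ring_adjoin \<int> a) b)"
    using AB.subset_fraction_field by (intro rat_adjoin_subset AB.subfield_set_fraction_field) auto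
  interpret Q: subfield_set "rat_adjoin {a, b}" by (rule subfield_set_rat_adjoin)
  have "a \<in> rat_adjoin {a, b}" "b \<in> rat_adjoin {a, b}" using subset_rat_adjoin by blast+
  then show "fraction_field (ring_adjoin (ring_adjoin \<int> a) b) \<subseteq> rat_adjoin {a, b}"
    by (intro fraction_field_subset Q.subfield_set_axioms Q.ring_adjoin_subset Q.Ints_subset)
qed

theorem theorem1p1:
  fixes p :: nat and \<zeta> \<alpha> \<beta> :: complex
  defines "R \<equiv> subring_on (cyclotomic_ring \<zeta>)"
  defines "\<pp> \<equiv> PIdl\<^bsub>R\<^esub> (1 - \<zeta>)"
  assumes "Factorial_Ring.prime p" and "odd p"
    and "primitive_root_of_unity p \<zeta>"
    and "\<alpha> \<in> cyclotomic_ring \<zeta>"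
    and "ring_irreducible\<^bsub>subring_on (polys_over (cyclotomic_ring \<zeta>))\<^esub>
           (Polynomial.monom 1 p - [:\<alpha>:])"
    and "poly (Polynomial.monom 1 p - [:\<alpha>:]) \<beta> = 0"
  shows "ring_of_integers (rat_adjoin {\<zeta>, \<beta>}) = ring_adjoin (cyclotomic_ring \<zeta>) \<beta> \<longleftrightarrow>
         squarefree_ideal R (PIdl\<^bsub>R\<^esub> \<alpha>) \<and>
         \<not> cong_mod_ideal (\<alpha> ^ p) \<alpha> (\<pp> \<cdot>\<^bsub>R\<^esub> \<pp>)"
proof -
  note irreducible = assms(7) and root = assms(8)
  interpret C: prime_cyclotomic p \<zeta> using assms(3,5) by unfold_locales
  have "\<beta> \<notin> cyclotomic_ring \<zeta>"
    by (rule ring_irreducible_imp_no_root[OF C.R.subring_set_axioms irreducible _ _ root])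
      (use assms(6) C.p_gt_1 in \<open>simp_all add: C.R.monom_minus_const_mem degree_monom_minus_const\<close>)
  moreover have "\<beta> ^ p = \<alpha>" using root by (simp add: poly_monom)
  ultimately interpret kummer p \<zeta> \<alpha> \<beta> using assms(4,6) by unfold_locales
  show ?thesis
    unfolding R_def \<pp>_def C.cong_mod_pi_squared_iff rat_adjoin_pair
    by (rule ring_of_integers_eq_B_iff)
qed

end
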